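(* Let $(M,\omega)$ be a symplectic manifold and let $G$ be a Lie group acting symplectically on $M$ with momentum map $J:M\to\mathfrak g^*$ (relative to a non-degenerate pairing $\kappa:\mathfrak g^*\times\mathfrak g\to\mathbb R$). Let $(P,\theta)$ be a Cartan geometry over a manifold $B$, modeled on a Klein pair $(\mathfrak a,\mathfrak g)$ with group $G$, which is an orbit through $m\in M$ (via $\chi:P\to M$), and let $\kappa_{\mathfrak a}$ be a duality of the Klein pair $(\mathfrak a,\mathfrak g)$. Assume that $J$ is $\mathfrak a$-equivariant (relative to $\kappa_{\mathfrak a}$) and that $\theta$ is torsion-free. Let $\zeta\in\mathfrak a_m$. If the Lie derivative $\mathcal L_{\zeta^*}\theta$ takes values in $\mathfrak g$, then the generalized Futaki invariant $F_\zeta:B\to\mathbb R$ is locally constant, i.e., constant on the connected components of $B$.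
   Context: Manifolds and Lie groups are smooth and possibly infinite-dimensional (modeled on locally convex spaces); linear and bilinear maps between topological vector spaces are understood to be continuous. A Klein pair $(\mathfrak a,\mathfrak g)$ with group $G$ consists of a Lie algebra $\mathfrak a$, a Lie subalgebra $\mathfrak g\subseteq\mathfrak a$ which is closed and has a closed topological complement, a Lie group $G$ with Lie algebra $\mathfrak g$, and a representation $\mathrm{Ad}$ of $G$ on $\mathfrak a$ restricting to the adjoint representation on $\mathfrak g$. ($\mathfrak a$ need not integrate to a Lie group.) A Cartan geometry $(P,\theta)$ modeled on $(\mathfrak a,\mathfrak g)$ with group $G$ on a manifold $B$ is a left principal $G$-bundle $\pi:P\to B$ with a $1$-form $\theta\in\Omega^1(P,\mathfrak a)$ such that $\theta_p:T_pP\to\mathfrak a$ is an isomorphism for all $p$, $\theta_{g\cdot p}(g\cdot X)=\mathrm{Ad}_g\theta_p(X)$ for all $g \in G$, $X\in T_pP$, and $\theta(\xi^* )=\xi$ for $\xi\in\mathfrak g$, where $\xi^*$ is the fundamental vector field. For $\xi\in\mathfrak a$, $\theta^{-1}(\xi)$ denotes the (smooth) vector field $p\mapsto\theta_p^{-1}(\xi)$. The curvature is $\Omega:=d\theta-\frac12[\theta\wedge\theta]\in\Omega^2(P,\mathfrak a)$, where $\frac12[\theta\wedge\theta](X,Y)=[\theta(X),\theta(Y)]$; $\theta$ is torsion-free if $\Omega$ takes values in $\mathfrak g$. $(P,\theta)$ is an orbit through $m\in M$ (where $G$ acts on $M$) if (i) there is a smooth $G$-equivariant map $\chi:P\to M$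 whose image contains $m$; (ii) there is a Lie subalgebra $\mathfrak a_m\subseteq\mathfrak a$ and a right Lie algebra action of $\mathfrak a_m$ on $P$, $\zeta\mapsto\zeta^*$, $\zeta^*_p=p\cdot\zeta$, commuting with the $G$-action and satisfying $T\chi(\zeta^* )=0$. Put $\rho_p(\xi):=T_p\chi(\theta_p^{-1}(\xi))\in T_{\chi(p)}M$ for $\xi\in\mathfrak a$. A momentum map relative to $\kappa$ is a smooth map $J:M\to\mathfrak g^*$ with $\omega_m(\xi\cdot m,X)+\kappa(T_mJ(X),\xi)=0$ for all $m\in M$, $X\in T_mM$, $\xi\in\mathfrak g$; here $\mathfrak g^*$ is a chosen vector space non-degenerately paired with $\mathfrak g$ by $\kappa$ (not necessarily the topological dual), and the coadjoint action on $\mathfrak g^*$ is dual to $\mathrm{Ad}$ via $\kappa$. Its non-equivariance $1$-cocycle $\sigma:G\to\mathfrak g^*$ is given by $J(g\cdot m)=\mathrm{Ad}^*_{g^{-1}}J(m)+\sigma(g)$ (independent of $m$). A duality of $(\mathfrak a,\mathfrak g)$ is an $\mathrm{Ad}_G$-invariant bilinear map $\kappa_{\mathfrak a}:\mathfrak g^*\times\mathfrak a\to\mathbb R$ vanishing on $\mathfrak g^*\times\mathfrak g$. The Calabi operator is $C_p:=T_{\chi(p)}J\circ\rho_p:\mathfrak a\to\mathfrak g^*$. $J$ is $\mathfrak a$-equivariant relative to $\kappa_{\mathfrak a}$ if $\kappa_{\mathfrak a}(C_p\xi,\eta)-\kappa_{\mathfrak a}(C_p\eta,\xi)=-\kappa_{\mathfrak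 a}(J(\chi(p)),[\xi,\eta])$ for all $p\in P$, $\xi,\eta\in\mathfrak a$, and $\kappa_{\mathfrak a}(\sigma(g),\xi)=0$ for all $g\in G$, $\xi\in\mathfrak a$. Generalized Futaki invariant: for $\zeta\in\mathfrak a_m$ and $J$ $\mathfrak a$-equivariant, the function $\tilde F_\zeta:P\to\mathbb R$, $\tilde F_\zeta(p)=\kappa_{\mathfrak a}\big(J(\chi(p)),\theta_p(p\cdot\zeta)\big)$, is $G$-invariant and hence descends to a function $F_\zeta:B\to\mathbb R$. *)

theory Defs
  imports "HOL-Analysis.Analysis" "HOL-Algebra.Group"
begin

section \<open>Locally convex spaces\<close>

class locally_convex_space = real_vector + topological_ab_group_add + t2_space +
  assumes tendsto_scaleR_Pair:
    "LIM z (nhds (c::real) \<times>\<^sub>F nhds x). fst z *\<^sub>R snd z :> nhds (c *\<^sub>R x)"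
  assumes convex_nbhd_base:
    "open U \<Longrightarrow> 0 \<in> U \<Longrightarrow> \<exists>V. open V \<and> 0 \<in> V \<and> V \<subseteq> U \<and>
       (\<forall>x\<in>V. \<forall>y\<in>V. \<forall>u\<ge>0. \<forall>v\<ge>0. u + v = (1::real) \<longrightarrow> u *\<^sub>R x + v *\<^sub>R y \<in> V)"

lemma tendsto_scaleR_lcs:
  fixes g :: "'b \<Rightarrow> 'a::locally_convex_space"
  shows "(f \<longlongrightarrow> a) F \<Longrightarrow> (g \<longlongrightarrow> b) F \<Longrightarrow> ((\<lambda>x. f x *\<^sub>R g x) \<longlongrightarrow> a *\<^sub>R b) F"
  using filterlim_compose[OF tendsto_scaleR_Pair, of "\<lambda>x. (f x, g x)" a b F]
  by (simp add: nhds_prod[symmetric] tendsto_Pair)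

lemma lcs_convex_nbhd:
  fixes U :: "'a::locally_convex_space set"
  assumes "open U" "0 \<in> U"
  shows "\<exists>V. open V \<and> convex V \<and> 0 \<in> V \<and> V \<subseteq> U"
  using convex_nbhd_base[OF assms] unfolding convex_def by metis

instance real :: locally_convex_space
proof
  show "LIM z (nhds c \<times>\<^sub>F nhds x). fst z *\<^sub>R snd z :> nhds (c *\<^sub>R x)" for c x :: real
    unfolding nhds_prod[symmetric]
    using tendsto_scaleR[OF tendsto_fst[OF filterlim_ident] tendsto_snd[OF filterlim_ident], of "(c, x)"]
    by simp
  fix U :: "real set" assume "open U" "0 \<in> U"
  then obtain e where e: "e > 0" "ball 0 e \<subseteq> U" by (auto simp: open_contains_ball)
  have "convex (ball (0::real) e)" by simp
  with e show "\<exists>V. open V \<and> 0 \<in> V \<and> V \<subseteq> U \<and>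
       (\<forall>x\<in>V. \<forall>y\<in>V. \<forall>u\<ge>0. \<forall>v\<ge>0. u + v = (1::real) \<longrightarrow> u *\<^sub>R x + v *\<^sub>R y \<in> V)"
    unfolding convex_def by (intro exI[of _ "ball 0 e"]) auto
qed

instance prod :: (topological_monoid_add, topological_monoid_add) topological_monoid_add
proof
  fix a b :: "'a \<times> 'b"
  have "((\<lambda>x. (fst (fst x) + fst (snd x), snd (fst x) + snd (snd x)))
          \<longlongrightarrow> (fst (fst (a, b)) + fst (snd (a, b)), snd (fst (a, b)) + snd (snd (a, b)))) (nhds (a, b))"
    by (intro tendsto_Pair tendsto_add tendsto_fst tendsto_snd filterlim_ident)
  then show "LIM x (nhds a \<times>\<^sub>F nhds b). fst x + snd x :> nhds (a + b)"
    by (simp add: nhds_prod plus_prod_def)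
qed

instance prod :: (topological_group_add, topological_group_add) topological_group_add
proof
  fix a :: "'a \<times> 'b"
  have "((\<lambda>x. (- fst x, - snd x)) \<longlongrightarrow> (- fst a, - snd a)) (nhds a)"
    by (intro tendsto_Pair tendsto_minus tendsto_fst tendsto_snd filterlim_ident)
  then show "(uminus \<longlongrightarrow> - a) (nhds a)"
    by (simp add: uminus_prod_def[abs_def])
qed

instance prod :: (topological_ab_group_add, topological_ab_group_add) topological_ab_group_add ..

instance prod :: (locally_convex_space, locally_convex_space) locally_convex_space
proof
  show "LIM z (nhds c \<times>\<^sub>F nhds x). fst z *\<^sub>R snd z :> nhds (c *\<^sub>R x)"
    for c :: real and x :: "'a \<times> 'b"
  proof -
    have "((\<lambda>z. (fst z *\<^sub>R fst (snd z), fst z *\<^sub>R snd (snd z))) \<longlongrightarrow> 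
            (fst (c, x) *\<^sub>R fst (snd (c, x)), fst (c, x) *\<^sub>R snd (snd (c, x)))) (nhds (c, x))"
      by (intro tendsto_Pair tendsto_scaleR_lcs tendsto_fst tendsto_snd filterlim_ident)
    then show ?thesis by (simp add: nhds_prod scaleR_prod_def)
  qed
  fix U :: "('a \<times> 'b) set" assume "open U" "0 \<in> U"
  then obtain A B where AB: "open A" "open B" "0 \<in> A \<times> B" "A \<times> B \<subseteq> U"
    by (metis open_prod_def)
  obtain A' where A': "open A'" "convex A'" "0 \<in> A'" "A' \<subseteq> A"
    using lcs_convex_nbhd[of A] AB by (auto simp: zero_prod_def)
  obtain B' where B': "open B'" "convex B'" "0 \<in> B'" "B' \<subseteq> B"
    using lcs_convex_nbhd[of B] AB by (auto simp: zero_prod_def)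
  have "convex (A' \<times> B')" using A' B' convex_Times by blast
  then show "\<exists>V. open V \<and> 0 \<in> V \<and> V \<subseteq> U \<and>
       (\<forall>x\<in>V. \<forall>y\<in>V. \<forall>u\<ge>0. \<forall>v\<ge>0. u + v = (1::real) \<longrightarrow> u *\<^sub>R x + v *\<^sub>R y \<in> V)"
    unfolding convex_def using A' B' AB
    by (intro exI[of _ "A' \<times> B'"] conjI open_Times) (auto simp: zero_prod_def)
qed

definition continuous_linear ::
    "('a::locally_convex_space \<Rightarrow> 'b::locally_convex_space) \<Rightarrow> bool" where
  "continuous_linear f \<longleftrightarrow> linear f \<and> continuous_on UNIV f"

definition continuous_bilinear ::
    "('a::locally_convex_space \<Rightarrow> 'b::locally_convex_space \<Rightarrow> 'c::locally_convex_space) \<Rightarrow> bool" where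
  "continuous_bilinear f \<longleftrightarrow>
     (\<forall>x. linear (f x)) \<and> (\<forall>y. linear (\<lambda>x. f x y)) \<and> continuous_on UNIV (\<lambda>(x, y). f x y)"

section \<open>Smooth maps between locally convex spaces\<close>

definition dir_quotient :: "('e::real_vector \<Rightarrow> 'f::real_vector) \<Rightarrow> 'e \<Rightarrow> 'e \<Rightarrow> real \<Rightarrow> 'f" where
  "dir_quotient f x v t = inverse t *\<^sub>R (f (x + t *\<^sub>R v) - f x)"

definition dir_differentiable ::
    "('e::locally_convex_space \<Rightarrow> 'f::locally_convex_space) \<Rightarrow> 'e \<Rightarrow> 'e \<Rightarrow> bool" where
  "dir_differentiable f x v \<longleftrightarrow> (\<exists>d. (dir_quotient f x v \<longlongrightarrow> d) (at 0))"

definition dir_deriv ::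
    "('e::locally_convex_space \<Rightarrow> 'f::locally_convex_space) \<Rightarrow> 'e \<Rightarrow> 'e \<Rightarrow> 'f" where
  "dir_deriv f x v = Lim (at 0) (dir_quotient f x v)"

text \<open>The iterated directional derivative $d^k f(x; v_0, \dots, v_{k-1})$. The directions are given
  by a sequence, of which only the first \<open>k\<close> entries matter.\<close>

primrec iter_deriv ::
    "nat \<Rightarrow> ('e::locally_convex_space \<Rightarrow> 'f::locally_convex_space) \<Rightarrow> (nat \<Rightarrow> 'e) \<Rightarrow> 'e \<Rightarrow> 'f" where
  "iter_deriv 0 f v = f"
| "iter_deriv (Suc k) f v = (\<lambda>x. dir_deriv (iter_deriv k f v) x (v k))"

text \<open>Smoothness in the sense of Michal--Bastiani: on the open set \<open>U\<close> all iterated directional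
  derivatives exist and are jointly continuous in the point and the directions. (For the product
  topology on \<^typ>\<open>nat \<Rightarrow> 'e\<close> this is continuity on $U \times E^k$.)\<close>

definition smooth_on ::
    "'e set \<Rightarrow> ('e::locally_convex_space \<Rightarrow> 'f::locally_convex_space) \<Rightarrow> bool" where
  "smooth_on U f \<longleftrightarrow> open U \<and>
     (\<forall>k. (\<forall>x\<in>U. \<forall>v. dir_differentiable (iter_deriv k f v) x (v k)) \<and>
          continuous_on (U \<times> UNIV) (\<lambda>(x, v). iter_deriv k f v x))"

section \<open>Manifolds\<close>

text \<open>A chart is a pair of its domain and the coordinate map. The underlying set of a manifold is a
  whole Hausdorff type; its smooth structure is an atlas of charts into the model space \<open>'e\<close>.\<close>

type_synonym ('m, 'e) chart = "'m set \<times> ('m \<Rightarrow> 'e)"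
type_synonym ('m, 'e) atlas = "('m, 'e) chart set"

abbreviation cdom :: "('m, 'e) chart \<Rightarrow> 'm set" where "cdom c \<equiv> fst c"
abbreviation coord :: "('m, 'e) chart \<Rightarrow> 'm \<Rightarrow> 'e" where "coord c \<equiv> snd c"

definition param :: "('m, 'e) chart \<Rightarrow> 'e \<Rightarrow> 'm" where
  "param c = inv_into (cdom c) (coord c)"

definition smooth_manifold :: "('m::t2_space, 'e::locally_convex_space) atlas \<Rightarrow> bool" where
  "smooth_manifold A \<longleftrightarrow>
     (\<Union>c\<in>A. cdom c) = UNIV \<and>
     (\<forall>c\<in>A. open (cdom c) \<and> open (coord c ` cdom c) \<and>
        homeomorphism (cdom c) (coord c ` cdom c) (coord c) (param c)) \<and>
     (\<forall>c\<in>A. \<forall>c'\<in>A. smooth_on (coord c ` (cdom c \<inter> cdom c')) (coord c' \<circ> param c))"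

definition std_atlas :: "('e, 'e::locally_convex_space) atlas" where
  "std_atlas = {(UNIV, \<lambda>x. x)}"

definition prod_atlas ::
    "('m, 'e) atlas \<Rightarrow> ('n, 'f) atlas \<Rightarrow> ('m \<times> 'n, 'e \<times> 'f) atlas" where
  "prod_atlas A A' = {(cdom c \<times> cdom c', map_prod (coord c) (coord c')) | c c'. c \<in> A \<and> c' \<in> A'}"

definition smooth_map_on ::
    "('m::topological_space, 'e::locally_convex_space) atlas \<Rightarrow>
     ('n::topological_space, 'f::locally_convex_space) atlas \<Rightarrow> 'm set \<Rightarrow> ('m \<Rightarrow> 'n) \<Rightarrow> bool" where
  "smooth_map_on A A' S f \<longleftrightarrow> open S \<and> continuous_on S f \<and>
     (\<forall>c\<in>A. \<forall>c'\<in>A'.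
        smooth_on (coord c ` (cdom c \<inter> S \<inter> f -` cdom c')) (coord c' \<circ> f \<circ> param c))"

abbreviation smooth_map ::
    "('m::topological_space, 'e::locally_convex_space) atlas \<Rightarrow>
     ('n::topological_space, 'f::locally_convex_space) atlas \<Rightarrow> ('m \<Rightarrow> 'n) \<Rightarrow> bool" where
  "smooth_map A A' f \<equiv> smooth_map_on A A' UNIV f"

text \<open>Tangent vectors at \<open>p\<close> are represented by their coordinates in a fixed chart \<open>chart_at A p\<close>
  around \<open>p\<close>. Thus the tangent space at every point is the model space \<open>'e\<close>, but the elements of
  \<open>'e\<close> that are tangent vectors at different points are coordinates in different charts; to pass to
  another chart \<open>c\<close>, use the tangent map of \<open>coord c\<close> or of \<open>param c\<close>.\<close>

definition chart_at :: "('m, 'e) atlas \<Rightarrow> 'm \<Rightarrow> ('m, 'e) chart" where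
  "chart_at A p = (SOME c. c \<in> A \<and> p \<in> cdom c)"

definition tangent_map ::
    "('m, 'e::locally_convex_space) atlas \<Rightarrow> ('n, 'f::locally_convex_space) atlas \<Rightarrow>
     ('m \<Rightarrow> 'n) \<Rightarrow> 'm \<Rightarrow> 'e \<Rightarrow> 'f" where
  "tangent_map A A' f p v =
     dir_deriv (coord (chart_at A' (f p)) \<circ> f \<circ> param (chart_at A p)) (coord (chart_at A p) p) v"

section \<open>Vector fields and differential forms\<close>

text \<open>The coordinate expressions of a vector field and of differential forms in a chart.\<close>

definition vf_in ::
    "('m, 'e::locally_convex_space) atlas \<Rightarrow> ('m, 'e) chart \<Rightarrow> ('m \<Rightarrow> 'e) \<Rightarrow> 'e \<Rightarrow> 'e" where
  "vf_in A c X y = tangent_map A std_atlas (coord c) (param c y) (X (param c y))"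

definition form1_in ::
    "('m, 'e::locally_convex_space) atlas \<Rightarrow> ('m, 'e) chart \<Rightarrow> ('m \<Rightarrow> 'e \<Rightarrow> 'a) \<Rightarrow> 'e \<Rightarrow> 'e \<Rightarrow> 'a" where
  "form1_in A c \<alpha> y v = \<alpha> (param c y) (tangent_map std_atlas A (param c) y v)"

definition form2_in ::
    "('m, 'e::locally_convex_space) atlas \<Rightarrow> ('m, 'e) chart \<Rightarrow> ('m \<Rightarrow> 'e \<Rightarrow> 'e \<Rightarrow> 'a) \<Rightarrow>
     'e \<Rightarrow> 'e \<Rightarrow> 'e \<Rightarrow> 'a" where
  "form2_in A c \<omega> y v w =
     \<omega> (param c y) (tangent_map std_atlas A (param c) y v) (tangent_map std_atlas A (param c) y w)"

definition smooth_vf :: "('m, 'e::locally_convex_space) atlas \<Rightarrow> ('m \<Rightarrow> 'e) \<Rightarrow> bool" where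
  "smooth_vf A X \<longleftrightarrow> (\<forall>c\<in>A. smooth_on (coord c ` cdom c) (vf_in A c X))"

definition one_form ::
    "('m, 'e::locally_convex_space) atlas \<Rightarrow> ('m \<Rightarrow> 'e \<Rightarrow> 'a::locally_convex_space) \<Rightarrow> bool" where
  "one_form A \<alpha> \<longleftrightarrow> (\<forall>p. continuous_linear (\<alpha> p)) \<and>
     (\<forall>c\<in>A. smooth_on ((coord c ` cdom c) \<times> UNIV) (\<lambda>(y, v). form1_in A c \<alpha> y v))"

definition two_form ::
    "('m, 'e::locally_convex_space) atlas \<Rightarrow> ('m \<Rightarrow> 'e \<Rightarrow> 'e \<Rightarrow> 'a::locally_convex_space) \<Rightarrow> bool" where
  "two_form A \<omega> \<longleftrightarrow> (\<forall>p. continuous_bilinear (\<omega> p) \<and> (\<forall>v. \<omega> p v v = 0)) \<and>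
     (\<forall>c\<in>A. smooth_on ((coord c ` cdom c) \<times> UNIV \<times> UNIV) (\<lambda>(y, v, w). form2_in A c \<omega> y v w))"

text \<open>The usual coordinate expressions of bracket, exterior derivative and Lie derivative, evaluated at
  \<open>p\<close> in the chart \<open>chart_at A p\<close>, in which tangent vectors at \<open>p\<close> are their own coordinates.
  Vector fields are bracketed as derivations, i.e. $[X,Y] = XY - YX$.\<close>

definition vf_bracket ::
    "('m, 'e::locally_convex_space) atlas \<Rightarrow> ('m \<Rightarrow> 'e) \<Rightarrow> ('m \<Rightarrow> 'e) \<Rightarrow> 'm \<Rightarrow> 'e" where
  "vf_bracket A X Y p =
     (let c = chart_at A p; x = coord c p
      in dir_deriv (vf_in A c Y) x (X p) - dir_deriv (vf_in A c X) x (Y p))"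

definition ext_deriv1 ::
    "('m, 'e::locally_convex_space) atlas \<Rightarrow> ('m \<Rightarrow> 'e \<Rightarrow> 'a::locally_convex_space) \<Rightarrow>
     'm \<Rightarrow> 'e \<Rightarrow> 'e \<Rightarrow> 'a" where
  "ext_deriv1 A \<alpha> p v w =
     (let c = chart_at A p; x = coord c p
      in dir_deriv (\<lambda>y. form1_in A c \<alpha> y w) x v - dir_deriv (\<lambda>y. form1_in A c \<alpha> y v) x w)"

definition ext_deriv2 ::
    "('m, 'e::locally_convex_space) atlas \<Rightarrow> ('m \<Rightarrow> 'e \<Rightarrow> 'e \<Rightarrow> 'a::locally_convex_space) \<Rightarrow>
     'm \<Rightarrow> 'e \<Rightarrow> 'e \<Rightarrow> 'e \<Rightarrow> 'a" where
  "ext_deriv2 A \<omega> p u v w =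
     (let c = chart_at A p; x = coord c p
      in dir_deriv (\<lambda>y. form2_in A c \<omega> y v w) x u + dir_deriv (\<lambda>y. form2_in A c \<omega> y w u) x v
         + dir_deriv (\<lambda>y. form2_in A c \<omega> y u v) x w)"

text \<open>This is $(\mathcal L_Z\alpha)(V) = Z(\alpha(V)) - \alpha([Z,V])$ for the vector field \<open>V\<close> with
  constant coordinates \<open>v\<close>. No flow of \<open>Z\<close> is needed.\<close>

definition lie_deriv1 ::
    "('m, 'e::locally_convex_space) atlas \<Rightarrow> ('m \<Rightarrow> 'e) \<Rightarrow> ('m \<Rightarrow> 'e \<Rightarrow> 'a::locally_convex_space) \<Rightarrow>
     'm \<Rightarrow> 'e \<Rightarrow> 'a" where
  "lie_deriv1 A Z \<alpha> p v =
     (let c = chart_at A p; x = coord c p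
      in dir_deriv (\<lambda>y. form1_in A c \<alpha> y v) x (Z p) + \<alpha> p (dir_deriv (vf_in A c Z) x v))"

section \<open>Lie groups and their actions\<close>

definition lie_group :: "'g::t2_space monoid \<Rightarrow> ('g, 'l::locally_convex_space) atlas \<Rightarrow> bool" where
  "lie_group G AG \<longleftrightarrow> group G \<and> carrier G = UNIV \<and> smooth_manifold AG \<and>
     smooth_map (prod_atlas AG AG) AG (\<lambda>(g, h). g \<otimes>\<^bsub>G\<^esub> h) \<and> smooth_map AG AG (m_inv G)"

text \<open>The Lie algebra of \<open>G\<close> is the tangent space \<open>'l\<close> at the identity, with the bracket of
  left-invariant vector fields.\<close>

definition left_invariant ::
    "'g monoid \<Rightarrow> ('g, 'l::locally_convex_space) atlas \<Rightarrow> 'l \<Rightarrow> 'g \<Rightarrow> 'l" where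
  "left_invariant G AG \<xi> g = tangent_map AG AG (\<lambda>h. g \<otimes>\<^bsub>G\<^esub> h) \<one>\<^bsub>G\<^esub> \<xi>"

definition lie_bracket ::
    "'g monoid \<Rightarrow> ('g, 'l::locally_convex_space) atlas \<Rightarrow> 'l \<Rightarrow> 'l \<Rightarrow> 'l" where
  "lie_bracket G AG \<xi> \<eta> = vf_bracket AG (left_invariant G AG \<xi>) (left_invariant G AG \<eta>) \<one>\<^bsub>G\<^esub>"

definition adjoint ::
    "'g monoid \<Rightarrow> ('g, 'l::locally_convex_space) atlas \<Rightarrow> 'g \<Rightarrow> 'l \<Rightarrow> 'l" where
  "adjoint G AG g \<xi> = tangent_map AG AG (\<lambda>h. g \<otimes>\<^bsub>G\<^esub> h \<otimes>\<^bsub>G\<^esub> m_inv G g) \<one>\<^bsub>G\<^esub> \<xi>"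

definition smooth_action ::
    "'g::t2_space monoid \<Rightarrow> ('g, 'l::locally_convex_space) atlas \<Rightarrow>
     ('m::t2_space, 'e::locally_convex_space) atlas \<Rightarrow> ('g \<Rightarrow> 'm \<Rightarrow> 'm) \<Rightarrow> bool" where
  "smooth_action G AG A act \<longleftrightarrow>
     (\<forall>p. act \<one>\<^bsub>G\<^esub> p = p) \<and> (\<forall>g h p. act (g \<otimes>\<^bsub>G\<^esub> h) p = act g (act h p)) \<and>
     smooth_map (prod_atlas AG A) A (\<lambda>(g, p). act g p)"

text \<open>$\xi \cdot p = \frac{d}{dt}\big|_0 \exp(t\xi)\cdot p$, the value at \<open>p\<close> of the fundamental
  vector field $\xi^*$ of a left action.\<close>

definition fundamental ::
    "'g monoid \<Rightarrow> ('g, 'l::locally_convex_space) atlas \<Rightarrow> ('m, 'e::locally_convex_space) atlas \<Rightarrow>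
     ('g \<Rightarrow> 'm \<Rightarrow> 'm) \<Rightarrow> 'l \<Rightarrow> 'm \<Rightarrow> 'e" where
  "fundamental G AG A act \<xi> p = tangent_map AG A (\<lambda>g. act g p) \<one>\<^bsub>G\<^esub> \<xi>"

definition principal_bundle ::
    "'g::t2_space monoid \<Rightarrow> ('g, 'l::locally_convex_space) atlas \<Rightarrow>
     ('p::t2_space, 'x::locally_convex_space) atlas \<Rightarrow>
     ('b::t2_space, 'y::locally_convex_space) atlas \<Rightarrow>
     ('g \<Rightarrow> 'p \<Rightarrow> 'p) \<Rightarrow> ('p \<Rightarrow> 'b) \<Rightarrow> bool" where
  "principal_bundle G AG AP AB act pr \<longleftrightarrow>
     lie_group G AG \<and> smooth_manifold AP \<and> smooth_manifold AB \<and>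
     smooth_action G AG AP act \<and> smooth_map AP AB pr \<and>
     (\<forall>b. \<exists>U \<Phi> \<Psi>. open U \<and> b \<in> U \<and>
        smooth_map_on AP (prod_atlas AG AB) (pr -` U) \<Phi> \<and>
        smooth_map_on (prod_atlas AG AB) AP (UNIV \<times> U) \<Psi> \<and>
        bij_betw \<Phi> (pr -` U) (UNIV \<times> U) \<and>
        (\<forall>p\<in>pr -` U. \<Psi> (\<Phi> p) = p) \<and>
        (\<forall>p\<in>pr -` U. snd (\<Phi> p) = pr p) \<and>
        (\<forall>g. \<forall>p\<in>pr -` U. pr (act g p) = pr p \<and> fst (\<Phi> (act g p)) = g \<otimes>\<^bsub>G\<^esub> fst (\<Phi> p)))"

section \<open>Symplectic actions and momentum maps\<close>

text \<open>Nondegeneracy is weak, i.e. injectivity of $X \mapsto \omega_m(X, \cdot)$.\<close>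

definition symplectic_manifold ::
    "('m::t2_space, 'e::locally_convex_space) atlas \<Rightarrow> ('m \<Rightarrow> 'e \<Rightarrow> 'e \<Rightarrow> real) \<Rightarrow> bool" where
  "symplectic_manifold A \<omega> \<longleftrightarrow> smooth_manifold A \<and> two_form A \<omega> \<and>
     (\<forall>p u v w. ext_deriv2 A \<omega> p u v w = 0) \<and>
     (\<forall>p v. (\<forall>w. \<omega> p v w = 0) \<longrightarrow> v = 0)"

definition symplectic_action ::
    "'g::t2_space monoid \<Rightarrow> ('g, 'l::locally_convex_space) atlas \<Rightarrow>
     ('m::t2_space, 'e::locally_convex_space) atlas \<Rightarrow> ('m \<Rightarrow> 'e \<Rightarrow> 'e \<Rightarrow> real) \<Rightarrow>
     ('g \<Rightarrow> 'm \<Rightarrow> 'm) \<Rightarrow> bool" where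
  "symplectic_action G AG A \<omega> act \<longleftrightarrow> smooth_action G AG A act \<and>
     (\<forall>g p v w. \<omega> (act g p) (tangent_map A A (act g) p v) (tangent_map A A (act g) p w) = \<omega> p v w)"

definition nondegenerate_pairing ::
    "('s::locally_convex_space \<Rightarrow> 'l::locally_convex_space \<Rightarrow> real) \<Rightarrow> bool" where
  "nondegenerate_pairing \<kappa> \<longleftrightarrow> continuous_bilinear \<kappa> \<and>
     (\<forall>\<mu>. (\<forall>\<xi>. \<kappa> \<mu> \<xi> = 0) \<longrightarrow> \<mu> = 0) \<and> (\<forall>\<xi>. (\<forall>\<mu>. \<kappa> \<mu> \<xi> = 0) \<longrightarrow> \<xi> = 0)"

text \<open>\<open>coad g\<close> is $\mathrm{Ad}^*_g$, the \<open>\<kappa>\<close>-dual of $\mathrm{Ad}_g$. Since the dual space is not the full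
  topological dual, its existence is part of the data; it is unique by nondegeneracy.\<close>

definition coadjoint_action ::
    "'g monoid \<Rightarrow> ('g, 'l::locally_convex_space) atlas \<Rightarrow>
     ('s::locally_convex_space \<Rightarrow> 'l \<Rightarrow> real) \<Rightarrow> ('g \<Rightarrow> 's \<Rightarrow> 's) \<Rightarrow> bool" where
  "coadjoint_action G AG \<kappa> coad \<longleftrightarrow> (\<forall>g. continuous_linear (coad g)) \<and>
     (\<forall>g \<mu> \<xi>. \<kappa> (coad g \<mu>) \<xi> = \<kappa> \<mu> (adjoint G AG g \<xi>))"

definition momentum_map ::
    "'g monoid \<Rightarrow> ('g, 'l::locally_convex_space) atlas \<Rightarrow>
     ('m::t2_space, 'e::locally_convex_space) atlas \<Rightarrow> ('m \<Rightarrow> 'e \<Rightarrow> 'e \<Rightarrow> real) \<Rightarrow>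
     ('g \<Rightarrow> 'm \<Rightarrow> 'm) \<Rightarrow> ('s::locally_convex_space \<Rightarrow> 'l \<Rightarrow> real) \<Rightarrow> ('m \<Rightarrow> 's) \<Rightarrow> bool" where
  "momentum_map G AG A \<omega> act \<kappa> J \<longleftrightarrow> smooth_map A std_atlas J \<and>
     (\<forall>m v \<xi>. \<omega> m (fundamental G AG A act \<xi> m) v + \<kappa> (tangent_map A std_atlas J m v) \<xi> = 0)"

definition nonequivariance_cocycle ::
    "'g monoid \<Rightarrow> ('g \<Rightarrow> 'm \<Rightarrow> 'm) \<Rightarrow> ('g \<Rightarrow> 's \<Rightarrow> 's::locally_convex_space) \<Rightarrow> ('m \<Rightarrow> 's) \<Rightarrow>
     ('g \<Rightarrow> 's) \<Rightarrow> bool" where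
  "nonequivariance_cocycle G act coad J \<sigma> \<longleftrightarrow>
     (\<forall>g m. J (act g m) = coad (m_inv G g) (J m) + \<sigma> g)"

section \<open>Klein pairs and Cartan geometries\<close>

definition lie_algebra :: "('a::locally_convex_space \<Rightarrow> 'a \<Rightarrow> 'a) \<Rightarrow> bool" where
  "lie_algebra br \<longleftrightarrow> continuous_bilinear br \<and> (\<forall>\<xi>. br \<xi> \<xi> = 0) \<and>
     (\<forall>\<xi> \<eta> \<zeta>. br \<xi> (br \<eta> \<zeta>) + br \<eta> (br \<zeta> \<xi>) + br \<zeta> (br \<xi> \<eta>) = 0)"

definition lie_subalgebra :: "('a::real_vector \<Rightarrow> 'a \<Rightarrow> 'a) \<Rightarrow> 'a set \<Rightarrow> bool" where
  "lie_subalgebra br S \<longleftrightarrow> subspace S \<and> (\<forall>\<xi>\<in>S. \<forall>\<eta>\<in>S. br \<xi> \<eta> \<in> S)"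

text \<open>\<open>q\<close> is the projection onto \<open>S\<close> along \<open>T\<close>.\<close>

definition topological_complement :: "'a::locally_convex_space set \<Rightarrow> 'a set \<Rightarrow> bool" where
  "topological_complement S T \<longleftrightarrow>
     (\<exists>q. continuous_linear q \<and> range q = S \<and> (\<forall>x\<in>S. q x = x) \<and> {x. q x = 0} = T)"

text \<open>The identification of the Lie algebra of \<open>G\<close> with the subalgebra \<open>\<gg>\<close> of the Lie algebra
  \<open>'a\<close> is the isomorphism \<open>\<iota>\<close>.\<close>

definition klein_pair ::
    "('a::locally_convex_space \<Rightarrow> 'a \<Rightarrow> 'a) \<Rightarrow> 'a set \<Rightarrow>
     'g::t2_space monoid \<Rightarrow> ('g, 'l::locally_convex_space) atlas \<Rightarrow> ('l \<Rightarrow> 'a) \<Rightarrow>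
     ('g \<Rightarrow> 'a \<Rightarrow> 'a) \<Rightarrow> bool" where
  "klein_pair br \<gg> G AG \<iota> Ad \<longleftrightarrow>
     lie_algebra br \<and> lie_subalgebra br \<gg> \<and> closed \<gg> \<and>
     (\<exists>\<hh>. closed \<hh> \<and> topological_complement \<gg> \<hh>) \<and>
     lie_group G AG \<and>
     linear \<iota> \<and> homeomorphism UNIV \<gg> \<iota> (inv_into UNIV \<iota>) \<and>
     (\<forall>\<xi> \<eta>. \<iota> (lie_bracket G AG \<xi> \<eta>) = br (\<iota> \<xi>) (\<iota> \<eta>)) \<and>
     (\<forall>g. linear (Ad g)) \<and> smooth_action G AG std_atlas Ad \<and>
     (\<forall>g \<xi>. Ad g (\<iota> \<xi>) = \<iota> (adjoint G AG g \<xi>))"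

text \<open>The vector field $\theta^{-1}(\xi)$.\<close>

definition const_vf :: "('p \<Rightarrow> 'x \<Rightarrow> 'a) \<Rightarrow> 'a \<Rightarrow> 'p \<Rightarrow> 'x" where
  "const_vf \<theta> \<xi> p = inv_into UNIV (\<theta> p) \<xi>"

definition cartan_geometry ::
    "'g::t2_space monoid \<Rightarrow> ('g, 'l::locally_convex_space) atlas \<Rightarrow>
     ('l \<Rightarrow> 'a::locally_convex_space) \<Rightarrow> ('g \<Rightarrow> 'a \<Rightarrow> 'a) \<Rightarrow>
     ('p::t2_space, 'x::locally_convex_space) atlas \<Rightarrow>
     ('b::t2_space, 'y::locally_convex_space) atlas \<Rightarrow>
     ('g \<Rightarrow> 'p \<Rightarrow> 'p) \<Rightarrow> ('p \<Rightarrow> 'b) \<Rightarrow> ('p \<Rightarrow> 'x \<Rightarrow> 'a) \<Rightarrow> bool" where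
  "cartan_geometry G AG \<iota> Ad AP AB act pr \<theta> \<longleftrightarrow>
     principal_bundle G AG AP AB act pr \<and>
     one_form AP \<theta> \<and>
     (\<forall>p. homeomorphism UNIV UNIV (\<theta> p) (inv_into UNIV (\<theta> p))) \<and>
     (\<forall>g p v. \<theta> (act g p) (tangent_map AP AP (act g) p v) = Ad g (\<theta> p v)) \<and>
     (\<forall>p \<xi>. \<theta> p (fundamental G AG AP act \<xi> p) = \<iota> \<xi>) \<and>
     (\<forall>\<xi>. smooth_vf AP (const_vf \<theta> \<xi>))"

definition curvature ::
    "('a::locally_convex_space \<Rightarrow> 'a \<Rightarrow> 'a) \<Rightarrow> ('p, 'x::locally_convex_space) atlas \<Rightarrow>
     ('p \<Rightarrow> 'x \<Rightarrow> 'a) \<Rightarrow> 'p \<Rightarrow> 'x \<Rightarrow> 'x \<Rightarrow> 'a" where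
  "curvature br AP \<theta> p v w = ext_deriv1 AP \<theta> p v w - br (\<theta> p v) (\<theta> p w)"

definition torsion_free ::
    "('a::locally_convex_space \<Rightarrow> 'a \<Rightarrow> 'a) \<Rightarrow> 'a set \<Rightarrow> ('p, 'x::locally_convex_space) atlas \<Rightarrow>
     ('p \<Rightarrow> 'x \<Rightarrow> 'a) \<Rightarrow> bool" where
  "torsion_free br \<gg> AP \<theta> \<longleftrightarrow> (\<forall>p v w. curvature br AP \<theta> p v w \<in> \<gg>)"

section \<open>Orbits and the generalized Futaki invariant\<close>

text \<open>\<open>star \<zeta> p\<close> is $\zeta^*_p = p \cdot \zeta$. The fundamental vector fields of a right action
  depend homomorphically (not anti-homomorphically) on \<open>\<zeta>\<close>.\<close>

definition right_lie_algebra_action ::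
    "('a::locally_convex_space \<Rightarrow> 'a \<Rightarrow> 'a) \<Rightarrow> 'a set \<Rightarrow> ('p::t2_space, 'x::locally_convex_space) atlas \<Rightarrow>
     ('a \<Rightarrow> 'p \<Rightarrow> 'x) \<Rightarrow> bool" where
  "right_lie_algebra_action br S AP star \<longleftrightarrow>
     (\<forall>\<zeta>\<in>S. smooth_vf AP (star \<zeta>)) \<and>
     (\<forall>\<zeta>\<in>S. \<forall>\<eta>\<in>S. \<forall>p. star (\<zeta> + \<eta>) p = star \<zeta> p + star \<eta> p) \<and>
     (\<forall>\<zeta>\<in>S. \<forall>c p. star (c *\<^sub>R \<zeta>) p = c *\<^sub>R star \<zeta> p) \<and>
     (\<forall>\<zeta>\<in>S. \<forall>\<eta>\<in>S. \<forall>p. star (br \<zeta> \<eta>) p = vf_bracket AP (star \<zeta>) (star \<eta>) p)"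

definition orbit_through ::
    "('a::locally_convex_space \<Rightarrow> 'a \<Rightarrow> 'a) \<Rightarrow>
     ('p::t2_space, 'x::locally_convex_space) atlas \<Rightarrow> ('m::t2_space, 'e::locally_convex_space) atlas \<Rightarrow>
     ('g \<Rightarrow> 'p \<Rightarrow> 'p) \<Rightarrow> ('g \<Rightarrow> 'm \<Rightarrow> 'm) \<Rightarrow>
     ('p \<Rightarrow> 'm) \<Rightarrow> 'a set \<Rightarrow> ('a \<Rightarrow> 'p \<Rightarrow> 'x) \<Rightarrow> 'm \<Rightarrow> bool" where
  "orbit_through br AP AM actP actM chi \<aa>\<^sub>m star m \<longleftrightarrow>
     smooth_map AP AM chi \<and> (\<forall>g p. chi (actP g p) = actM g (chi p)) \<and> m \<in> range chi \<and>
     lie_subalgebra br \<aa>\<^sub>m \<and> right_lie_algebra_action br \<aa>\<^sub>m AP star \<and>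
     (\<forall>\<zeta>\<in>\<aa>\<^sub>m. \<forall>g p. star \<zeta> (actP g p) = tangent_map AP AP (actP g) p (star \<zeta> p)) \<and>
     (\<forall>\<zeta>\<in>\<aa>\<^sub>m. \<forall>p. tangent_map AP AM chi p (star \<zeta> p) = 0)"

definition rho ::
    "('p, 'x::locally_convex_space) atlas \<Rightarrow> ('m, 'e::locally_convex_space) atlas \<Rightarrow>
     ('p \<Rightarrow> 'm) \<Rightarrow> ('p \<Rightarrow> 'x \<Rightarrow> 'a) \<Rightarrow> 'p \<Rightarrow> 'a \<Rightarrow> 'e" where
  "rho AP AM chi \<theta> p \<xi> = tangent_map AP AM chi p (const_vf \<theta> \<xi> p)"

definition duality ::
    "'g monoid \<Rightarrow> 'a::locally_convex_space set \<Rightarrow> ('g \<Rightarrow> 'a \<Rightarrow> 'a) \<Rightarrow>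
     ('g \<Rightarrow> 's \<Rightarrow> 's::locally_convex_space) \<Rightarrow> ('s \<Rightarrow> 'a \<Rightarrow> real) \<Rightarrow> bool" where
  "duality G \<gg> Ad coad \<kappa>\<^sub>a \<longleftrightarrow> continuous_bilinear \<kappa>\<^sub>a \<and>
     (\<forall>g \<mu> \<xi>. \<kappa>\<^sub>a (coad (m_inv G g) \<mu>) (Ad g \<xi>) = \<kappa>\<^sub>a \<mu> \<xi>) \<and>
     (\<forall>\<mu>. \<forall>\<xi>\<in>\<gg>. \<kappa>\<^sub>a \<mu> \<xi> = 0)"

definition calabi ::
    "('p, 'x::locally_convex_space) atlas \<Rightarrow> ('m, 'e::locally_convex_space) atlas \<Rightarrow>
     ('p \<Rightarrow> 'm) \<Rightarrow> ('p \<Rightarrow> 'x \<Rightarrow> 'a) \<Rightarrow> ('m \<Rightarrow> 's::locally_convex_space) \<Rightarrow> 'p \<Rightarrow> 'a \<Rightarrow> 's" where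
  "calabi AP AM chi \<theta> J p \<xi> = tangent_map AM std_atlas J (chi p) (rho AP AM chi \<theta> p \<xi>)"

definition alg_equivariant ::
    "('a::locally_convex_space \<Rightarrow> 'a \<Rightarrow> 'a) \<Rightarrow>
     ('p, 'x::locally_convex_space) atlas \<Rightarrow> ('m, 'e::locally_convex_space) atlas \<Rightarrow>
     ('p \<Rightarrow> 'm) \<Rightarrow> ('p \<Rightarrow> 'x \<Rightarrow> 'a) \<Rightarrow> ('s::locally_convex_space \<Rightarrow> 'a \<Rightarrow> real) \<Rightarrow>
     ('m \<Rightarrow> 's) \<Rightarrow> ('g \<Rightarrow> 's) \<Rightarrow> bool" where
  "alg_equivariant br AP AM chi \<theta> \<kappa>\<^sub>a J \<sigma> \<longleftrightarrow>
     (\<forall>p \<xi> \<eta>. \<kappa>\<^sub>a (calabi AP AM chi \<theta> J p \<xi>) \<eta> - \<kappa>\<^sub>a (calabi AP AM chi \<theta> J p \<eta>) \<xi>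
                = - \<kappa>\<^sub>a (J (chi p)) (br \<xi> \<eta>)) \<and>
     (\<forall>g \<xi>. \<kappa>\<^sub>a (\<sigma> g) \<xi> = 0)"

definition futaki_lift ::
    "('p \<Rightarrow> 'm) \<Rightarrow> ('p \<Rightarrow> 'x \<Rightarrow> 'a) \<Rightarrow> ('s \<Rightarrow> 'a \<Rightarrow> real) \<Rightarrow> ('m \<Rightarrow> 's) \<Rightarrow> ('a \<Rightarrow> 'p \<Rightarrow> 'x) \<Rightarrow>
     'a \<Rightarrow> 'p \<Rightarrow> real" where
  "futaki_lift chi \<theta> \<kappa>\<^sub>a J star \<zeta> p = \<kappa>\<^sub>a (J (chi p)) (\<theta> p (star \<zeta> p))"

text \<open>The function on the base to which \<open>futaki_lift\<close> descends.\<close>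

definition futaki ::
    "('p \<Rightarrow> 'b) \<Rightarrow> ('p \<Rightarrow> 'm) \<Rightarrow> ('p \<Rightarrow> 'x \<Rightarrow> 'a) \<Rightarrow> ('s \<Rightarrow> 'a \<Rightarrow> real) \<Rightarrow> ('m \<Rightarrow> 's) \<Rightarrow>
     ('a \<Rightarrow> 'p \<Rightarrow> 'x) \<Rightarrow> 'a \<Rightarrow> 'b \<Rightarrow> real" where
  "futaki pr chi \<theta> \<kappa>\<^sub>a J star \<zeta> b = (THE c. \<forall>p. pr p = b \<longrightarrow> futaki_lift chi \<theta> \<kappa>\<^sub>a J star \<zeta> p = c)"

end

theory Submission
  imports Defs
begin

text \<open>Write $h = J \circ \chi$ and $Z = \zeta^*$, and let $\tilde F(p) = \kappa_a(h(p), \theta_p(Z_p))$ be the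
lift of the Futaki invariant to $P$. The heart of the matter is that $d\tilde F = 0$. For a tangent
vector $v$ at $p$ put $\xi = \theta_p(v)$ and $\eta = \theta_p(Z_p)$. The product rule gives
\[ d\tilde F(v) = \kappa_a(dh(v), \eta) + \kappa_a(h(p), d(\theta(Z))(v)). \]
In a chart, the terms in which $\theta$ is differentiated in the direction $Z$ cancel in
\[ d(\theta(Z))(v) = (\mathcal L_Z\theta)(v) + d\theta(v, Z)
     = (\mathcal L_Z\theta)(v) + \Omega(v, Z) + [\xi, \eta]. \]
The first two summands are in $\mathfrak g$, by the hypothesis on \<open>\<zeta>\<close> and by torsion-freeness, and
$\kappa_a$ vanishes there; only $\kappa_a(h(p), [\xi,\eta])$ survives. On the other hand
$dh(v) = C_p\xi$, while $C_p\eta = 0$ because $Z$ is tangent to the fibres of $\chi$, so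
equivariance of $J$ reads $\kappa_a(C_p\xi,\eta) = -\kappa_a(h(p),[\xi,\eta])$. The two terms cancel.

The derivatives are taken along curves. A tangent vector at $p$ is expressed in a chart that
depends on $p$, so the straight segments of a fixed chart become curves in the chart of each of
their points, and it is along these that \<open>futaki_lift_stationary\<close> differentiates $\tilde F$.
Convex neighbourhoods in a single chart then make $\tilde F$ locally constant
(\<open>locally_constant_if_stationary\<close>). Since $G$ is transitive on the fibres of $P$, the invariant
function $\tilde F$ descends, and composing it with continuous local sections carries the local
constancy over to $B$.

The main analytic input is the chain rule for smooth maps between locally convex spaces. It rests on
the mean value principle \<open>difference_quotient_in_convex\<close>: a difference quotient
stays in every open convex set that contains all velocities of the curve. This has an elementary
proof by bisection and so requires neither integration nor the Hahn--Banach theorem.\<close>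

section \<open>Calculus along curves in locally convex spaces\<close>

definition has_velocity :: "(real \<Rightarrow> 'e::locally_convex_space) \<Rightarrow> 'e \<Rightarrow> real \<Rightarrow> bool" where
  "has_velocity \<gamma> v t \<longleftrightarrow> ((\<lambda>s. inverse s *\<^sub>R (\<gamma> (t + s) - \<gamma> t)) \<longlongrightarrow> v) (at 0)"

lemma has_velocity_unique: "has_velocity \<gamma> v t \<Longrightarrow> has_velocity \<gamma> w t \<Longrightarrow> v = w"
  unfolding has_velocity_def by (rule tendsto_unique[rotated]) auto

lemma has_velocity_real_iff: "has_velocity f d t \<longleftrightarrow> (f has_real_derivative d) (at t)"
  unfolding has_velocity_def DERIV_def by (simp add: divide_inverse mult.commute)

lemma has_velocity_imp_tendsto:
  assumes "has_velocity \<gamma> v t"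
  shows "((\<lambda>s. \<gamma> (t + s)) \<longlongrightarrow> \<gamma> t) (at 0)"
proof -
  have "((\<lambda>s. s *\<^sub>R (inverse s *\<^sub>R (\<gamma> (t + s) - \<gamma> t)) + \<gamma> t) \<longlongrightarrow> 0 *\<^sub>R v + \<gamma> t) (at 0)"
    using assms unfolding has_velocity_def
    by (intro tendsto_add tendsto_scaleR_lcs tendsto_const) (auto intro: tendsto_ident_at)
  then have "((\<lambda>s. s *\<^sub>R (inverse s *\<^sub>R (\<gamma> (t + s) - \<gamma> t)) + \<gamma> t) \<longlongrightarrow> \<gamma> t) (at 0)"
    by simp
  moreover have "\<forall>\<^sub>F s in at 0. s *\<^sub>R (inverse s *\<^sub>R (\<gamma> (t + s) - \<gamma> t)) + \<gamma> t = \<gamma> (t + s)"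
    by (auto simp: eventually_at_filter)
  ultimately show ?thesis by (rule Lim_transform_eventually)
qed

lemma has_velocity_line: "has_velocity (\<lambda>s. x + s *\<^sub>R v) v t"
proof -
  have "\<forall>\<^sub>F s in at 0. v = inverse s *\<^sub>R ((x + (t + s) *\<^sub>R v) - (x + t *\<^sub>R v))"
    by (auto simp: eventually_at_filter algebra_simps)
  then show ?thesis unfolding has_velocity_def
    by (rule Lim_transform_eventually[OF tendsto_const])
qed

lemma has_velocity_cong:
  assumes "\<forall>\<^sub>F s in at 0. f (t + s) = g (t + s)" and "f t = g t"
  shows "has_velocity f v t \<longleftrightarrow> has_velocity g v t"
  unfolding has_velocity_def
  by (rule tendsto_cong, rule eventually_mono[OF assms(1)]) (simp add: assms(2))

lemma dir_deriv_eqI: "(dir_quotient f x v \<longlongrightarrow> d) (at 0) \<Longrightarrow> dir_deriv f x v = d"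
  unfolding dir_deriv_def by (rule tendsto_Lim) auto

lemma tendsto_dir_deriv:
  "dir_differentiable f x v \<Longrightarrow> (dir_quotient f x v \<longlongrightarrow> dir_deriv f x v) (at 0)"
  unfolding dir_differentiable_def using dir_deriv_eqI by metis

lemma tendsto_line:
  "((\<lambda>s. x + s *\<^sub>R v) \<longlongrightarrow> (x::'e::locally_convex_space)) (at (0::real))"
  using has_velocity_imp_tendsto[OF has_velocity_line[of x v 0]] by simp

lemma eventually_line_in_open:
  fixes x :: "'e::locally_convex_space"
  shows "open U \<Longrightarrow> x \<in> U \<Longrightarrow> \<forall>\<^sub>F s in at (0::real). x + s *\<^sub>R v \<in> U"
  using topological_tendstoD[OF tendsto_line] by blast

lemma dir_deriv_cong:
  assumes "open U" "x \<in> U" "\<And>y. y \<in> U \<Longrightarrow> f y = g y"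
  shows "dir_deriv f x v = dir_deriv g x v"
proof -
  have "\<forall>\<^sub>F s in at 0. dir_quotient f x v s = dir_quotient g x v s"
    by (rule eventually_mono[OF eventually_line_in_open[OF assms(1,2), of v]])
       (simp add: dir_quotient_def assms)
  then show ?thesis unfolding dir_deriv_def by (intro Lim_cong) auto
qed

lemma dir_deriv_linear:
  assumes "linear f"
  shows "dir_deriv f x v = f v"
proof (rule dir_deriv_eqI)
  have "\<forall>\<^sub>F s in at 0. f v = dir_quotient f x v s"
    by (auto simp: eventually_at_filter dir_quotient_def linear_add[OF assms] linear_scale[OF assms])
  then show "(dir_quotient f x v \<longlongrightarrow> f v) (at 0)"
    by (rule Lim_transform_eventually[OF tendsto_const])
qed

lemma dir_deriv_ident: "dir_deriv (\<lambda>y. y) x v = v"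
  by (rule dir_deriv_linear) (simp add: linear_iff)

lemma dir_deriv_const [simp]: "dir_deriv (\<lambda>_. c) x v = 0"
  by (rule dir_deriv_eqI) (simp add: dir_quotient_def[abs_def])

lemma dir_deriv_zero_direction [simp]: "dir_deriv f x 0 = 0"
  by (rule dir_deriv_eqI) (simp add: dir_quotient_def[abs_def])

lemma smooth_on_imp_open: "smooth_on U f \<Longrightarrow> open U"
  by (simp add: smooth_on_def)

lemma smooth_on_imp_dir_differentiable:
  assumes "smooth_on U f" "x \<in> U"
  shows "dir_differentiable f x v"
  using assms unfolding smooth_on_def
  by (metis iter_deriv.simps(1))

lemma smooth_on_imp_continuous_deriv:
  assumes "smooth_on U f"
  shows "continuous_on (U \<times> UNIV) (\<lambda>(x, v). dir_deriv f x v)"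
proof -
  have "continuous_on (U \<times> UNIV) (\<lambda>(x, v). iter_deriv (Suc 0) f v x)"
    using assms unfolding smooth_on_def by blast
  then have deriv: "continuous_on (U \<times> UNIV) (\<lambda>(x, v). dir_deriv f x (v (0::nat)))"
    by simp
  \<comment> \<open>a single direction becomes the sequence of directions that is constant\<close>
  have "continuous_on (U \<times> UNIV) (\<lambda>z. (fst z, \<lambda>_::nat. snd z))"
    by (intro continuous_on_Pair continuous_on_coordinatewise_then_product continuous_intros)
  from this continuous_on_subset[OF deriv]
  have "continuous_on (U \<times> UNIV)
      ((\<lambda>(x, v). dir_deriv f x (v (0::nat))) \<circ> (\<lambda>z. (fst z, \<lambda>_::nat. snd z)))"
    by (rule continuous_on_compose) auto
  then show ?thesis by (simp add: comp_def case_prod_beta)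
qed

text \<open>Being a difference quotient in \<open>K\<close> is a local property of short intervals around a point, because
\<open>K\<close> is open, and is inherited by concatenated intervals, because the quotient over the union is a convex
combination of the two quotients. Bolzano's bisection argument globalizes it.\<close>

lemma difference_quotient_in_convex_aux:
  fixes \<phi> :: "real \<Rightarrow> 'f::locally_convex_space"
  assumes "open K" "convex K" and "a < b"
    and vel: "\<And>s. a \<le> s \<Longrightarrow> s \<le> b \<Longrightarrow> \<exists>d\<in>K. has_velocity \<phi> d s"
  shows "inverse (b - a) *\<^sub>R (\<phi> b - \<phi> a) \<in> K"
proof -
  define P where "P u v \<longleftrightarrow> (u < v \<longrightarrow> inverse (v - u) *\<^sub>R (\<phi> v - \<phi> u) \<in> K)" for u v
  have glue: "P u w" if "P u v" "P v w" "u \<le> v" "v \<le> w" for u v w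
  proof (cases "u < v \<and> v < w")
    case True
    have "((v - u) / (w - u)) *\<^sub>R (inverse (v - u) *\<^sub>R (\<phi> v - \<phi> u)) +
          ((w - v) / (w - u)) *\<^sub>R (inverse (w - v) *\<^sub>R (\<phi> w - \<phi> v)) \<in> K"
      using True that unfolding P_def
      by (intro convexD[OF \<open>convex K\<close>]) (auto simp: add_divide_distrib[symmetric])
    moreover have "((v - u) / (w - u)) *\<^sub>R (inverse (v - u) *\<^sub>R (\<phi> v - \<phi> u)) +
          ((w - v) / (w - u)) *\<^sub>R (inverse (w - v) *\<^sub>R (\<phi> w - \<phi> v))
        = inverse (w - u) *\<^sub>R (\<phi> v - \<phi> u) + inverse (w - u) *\<^sub>R (\<phi> w - \<phi> v)"
    proof -
      have "((v - u) / (w - u)) * inverse (v - u) = inverse (w - u)"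
        "((w - v) / (w - u)) * inverse (w - v) = inverse (w - u)"
        using True by (simp_all add: divide_inverse)
      then show ?thesis by (simp only: scaleR_scaleR)
    qed
    moreover have "\<dots> = inverse (w - u) *\<^sub>R (\<phi> w - \<phi> u)"
      by (simp add: scaleR_add_right[symmetric])
    ultimately show ?thesis by (simp add: P_def)
  next
    case False
    then have "u = v \<or> v = w" using that by auto
    then show ?thesis using that by auto
  qed
  have "P a b"
  proof (rule Bolzano)
    show "a \<le> b" using \<open>a < b\<close> by simp
    show "P u w" if "P u v" "P v w" "u \<le> v" "v \<le> w" for u v w using glue that .
    show "\<exists>d>0. \<forall>u v. u \<le> s \<and> s \<le> v \<and> v - u < d \<longrightarrow> P u v" if s: "a \<le> s" "s \<le> b" for s
    proof -
      obtain k where k: "k \<in> K" "has_velocity \<phi> k s" using vel s by blast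
      then have "\<forall>\<^sub>F h in at 0. inverse h *\<^sub>R (\<phi> (s + h) - \<phi> s) \<in> K"
        unfolding has_velocity_def using \<open>open K\<close> topological_tendstoD by blast
      then obtain d where "d > 0"
        and d: "\<And>h. h \<noteq> 0 \<Longrightarrow> \<bar>h\<bar> < d \<Longrightarrow> inverse h *\<^sub>R (\<phi> (s + h) - \<phi> s) \<in> K"
        unfolding eventually_at by (auto simp: dist_real_def)
      have "P u v" if "u \<le> s" "s \<le> v" "v - u < d" for u v
      proof (rule glue[where v = s])
        show "P s v" using d[of "v - s"] that by (auto simp: P_def)
        show "P u s"
          unfolding P_def
        proof
          assume "u < s"
          then have "inverse (u - s) *\<^sub>R (\<phi> u - \<phi> s) \<in> K" using d[of "u - s"] that by auto
          also have "inverse (u - s) *\<^sub>R (\<phi> u - \<phi> s) = inverse (s - u) *\<^sub>R (\<phi> s - \<phi> u)"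
            by (metis inverse_minus_eq minus_diff_eq scaleR_minus_left scaleR_minus_right minus_minus)
          finally show "inverse (s - u) *\<^sub>R (\<phi> s - \<phi> u) \<in> K" .
        qed
      qed (use that in auto)
      with \<open>d > 0\<close> show ?thesis by blast
    qed
  qed
  then show ?thesis using \<open>a < b\<close> by (simp add: P_def)
qed

text \<open>Either orientation of the interval is allowed, since derivatives are limits from both sides.\<close>

lemma difference_quotient_in_convex:
  fixes \<phi> :: "real \<Rightarrow> 'f::locally_convex_space"
  assumes "open K" "convex K" and "a \<noteq> b"
    and vel: "\<And>s. s \<in> closed_segment a b \<Longrightarrow> \<exists>d\<in>K. has_velocity \<phi> d s"
  shows "inverse (b - a) *\<^sub>R (\<phi> b - \<phi> a) \<in> K"
proof (cases "a < b")
  case True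
  then show ?thesis
    using assms by (intro difference_quotient_in_convex_aux) (auto simp: closed_segment_eq_real_ivl)
next
  case False
  then have "inverse (a - b) *\<^sub>R (\<phi> a - \<phi> b) \<in> K"
    using assms by (intro difference_quotient_in_convex_aux) (auto simp: closed_segment_eq_real_ivl)
  moreover have "inverse (a - b) *\<^sub>R (\<phi> a - \<phi> b) = inverse (b - a) *\<^sub>R (\<phi> b - \<phi> a)"
    by (metis inverse_minus_eq minus_diff_eq scaleR_minus_left scaleR_minus_right minus_minus)
  ultimately show ?thesis by simp
qed

lemma convex_open_nbhd:
  fixes x :: "'e::locally_convex_space"
  assumes "open U" "x \<in> U"
  obtains K where "open K" "convex K" "x \<in> K" "K \<subseteq> U"
proof -
  have cont: "continuous_on UNIV (\<lambda>y. c + y)" for c :: 'e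
    by (intro continuous_intros)
  have tr: "open ((+) c ` S)" if "open S" for c and S :: "'e set"
  proof -
    have "(+) c ` S = (\<lambda>y. - c + y) -` S" by force
    then show ?thesis using open_vimage[OF that cont[of "- c"]] by simp
  qed
  obtain V where V: "open V" "convex V" "0 \<in> V" "V \<subseteq> (+) (- x) ` U"
    using lcs_convex_nbhd[OF tr[OF assms(1), of "- x"]] assms(2) by (metis add.left_inverse imageI)
  show thesis
  proof
    show "open ((+) x ` V)" using tr V by blast
    show "convex ((+) x ` V)" using V by (simp add: convex_translation)
    show "x \<in> (+) x ` V" using V(3) by force
    show "(+) x ` V \<subseteq> U" using V(4) by force
  qed
qed

text \<open>Joint continuity of the derivative keeps all velocities of \<open>f\<close> along a short segment near \<open>x\<close> inside a
given convex neighbourhood of the derivative; the mean value principle then does the same for the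
difference quotient. That the base point may move with the parameter is what allows differentiation
in one argument of a function of two variables while the other one varies as well.\<close>

lemma strictly_differentiable:
  fixes f :: "'e::locally_convex_space \<Rightarrow> 'f::locally_convex_space"
  assumes sm: "smooth_on U f" and "x \<in> U"
    and X: "(X \<longlongrightarrow> x) (at (0::real))" and W: "(W \<longlongrightarrow> w) (at 0)"
  shows "((\<lambda>s. inverse s *\<^sub>R (f (X s + s *\<^sub>R W s) - f (X s))) \<longlongrightarrow> dir_deriv f x w) (at 0)"
proof (rule topological_tendstoI)
  fix N assume "open N" "dir_deriv f x w \<in> N"
  then obtain K where K: "open K" "convex K" "dir_deriv f x w \<in> K" "K \<subseteq> N"
    by (rule convex_open_nbhd)
  have "open U" using sm by (rule smooth_on_imp_open)
  then have "open (U \<times> (UNIV :: 'e set))" by (simp add: open_Times)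
  with smooth_on_imp_continuous_deriv[OF sm] \<open>open K\<close>
  have "open ((\<lambda>(x, v). dir_deriv f x v) -` K \<inter> (U \<times> UNIV))"
    by (metis continuous_on_open_vimage)
  moreover have "(x, w) \<in> (\<lambda>(x, v). dir_deriv f x v) -` K \<inter> (U \<times> UNIV)"
    using K \<open>x \<in> U\<close> by simp
  ultimately obtain A B where AB: "open A" "open B" "x \<in> A" "w \<in> B"
    "A \<times> B \<subseteq> (\<lambda>(x, v). dir_deriv f x v) -` K \<inter> (U \<times> UNIV)"
    by (rule open_prod_elim) blast
  obtain A' where A': "open A'" "convex A'" "x \<in> A'" "A' \<subseteq> A"
    using convex_open_nbhd[OF AB(1,3)] .
  have "((\<lambda>s. X s + s *\<^sub>R W s) \<longlongrightarrow> x + 0 *\<^sub>R w) (at 0)"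
    by (intro tendsto_add tendsto_scaleR_lcs X W tendsto_ident_at)
  then have "\<forall>\<^sub>F s in at 0. X s + s *\<^sub>R W s \<in> A'"
    using A' topological_tendstoD by fastforce
  moreover have "\<forall>\<^sub>F s in at 0. X s \<in> A'" using X A' topological_tendstoD by blast
  moreover have "\<forall>\<^sub>F s in at 0. W s \<in> B" using W AB topological_tendstoD by blast
  moreover have "\<forall>\<^sub>F s in at 0. s \<noteq> (0::real)" by (simp add: eventually_at_filter)
  ultimately have "\<forall>\<^sub>F s in at 0. inverse s *\<^sub>R (f (X s + s *\<^sub>R W s) - f (X s)) \<in> K"
  proof eventually_elim
    case (elim s)
    have "\<exists>d\<in>K. has_velocity (\<lambda>r. f (X s + r *\<^sub>R W s)) d r" if r: "r \<in> closed_segment 0 s" for r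
    proof -
      obtain u where u: "0 \<le> u" "u \<le> 1" "r = u * s" using r by (auto simp: in_segment)
      have "(1 - u) *\<^sub>R X s + u *\<^sub>R (X s + s *\<^sub>R W s) \<in> A'"
        using u elim by (intro convexD[OF A'(2)]) auto
      moreover have "(1 - u) *\<^sub>R X s + u *\<^sub>R (X s + s *\<^sub>R W s) = X s + r *\<^sub>R W s"
        using u by (simp add: algebra_simps)
      ultimately have "X s + r *\<^sub>R W s \<in> A" using A' by auto
      with elim AB have *: "X s + r *\<^sub>R W s \<in> U" "dir_deriv f (X s + r *\<^sub>R W s) (W s) \<in> K"
        by auto
      have "has_velocity (\<lambda>r. f (X s + r *\<^sub>R W s)) (dir_deriv f (X s + r *\<^sub>R W s) (W s)) r"
        using tendsto_dir_deriv[OF smooth_on_imp_dir_differentiable[OF sm *(1)], of "W s"]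
        unfolding has_velocity_def dir_quotient_def[abs_def]
        by (simp add: scaleR_add_left add.assoc)
      with * show ?thesis by blast
    qed
    then have "inverse (s - 0) *\<^sub>R (f (X s + s *\<^sub>R W s) - f (X s + 0 *\<^sub>R W s)) \<in> K"
      using elim by (intro difference_quotient_in_convex[OF K(1,2)]) auto
    then show ?case by simp
  qed
  then show "\<forall>\<^sub>F s in at 0. inverse s *\<^sub>R (f (X s + s *\<^sub>R W s) - f (X s)) \<in> N"
    by (rule eventually_mono) (use K in auto)
qed

text \<open>The increment of \<open>\<gamma>\<close> is its difference quotient times the
step, so this is strict differentiability with a fixed base point and a moving direction.\<close>

lemma has_velocity_compose:
  assumes sm: "smooth_on U f" and "\<gamma> t \<in> U" and vel: "has_velocity \<gamma> v t"
  shows "has_velocity (\<lambda>s. f (\<gamma> s)) (dir_deriv f (\<gamma> t) v) t"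
proof -
  have "((\<lambda>s. inverse s *\<^sub>R (f (\<gamma> t + s *\<^sub>R (inverse s *\<^sub>R (\<gamma> (t + s) - \<gamma> t))) - f (\<gamma> t)))
          \<longlongrightarrow> dir_deriv f (\<gamma> t) v) (at 0)"
    using vel unfolding has_velocity_def
    by (intro strictly_differentiable[OF sm \<open>\<gamma> t \<in> U\<close>] tendsto_const)
  then show ?thesis unfolding has_velocity_def
    by (rule Lim_transform_eventually) (auto simp: eventually_at_filter)
qed

text \<open>The increment is split into a step in the first argument and a step in the second argument, the latter
from the base point \<open>(\<gamma> (t + s), \<eta> t)\<close>. In this form the sum of the partial derivatives
appears without knowing that the derivative is additive in the direction.\<close>

lemma has_velocity_compose2:
  assumes sm: "smooth_on U (\<lambda>(y, z). f y z)" and U: "(\<gamma> t, \<eta> t) \<in> U"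
    and vel: "has_velocity \<gamma> v t" "has_velocity \<eta> w t"
  shows "has_velocity (\<lambda>s. f (\<gamma> s) (\<eta> s))
           (dir_deriv (\<lambda>y. f y (\<eta> t)) (\<gamma> t) v + dir_deriv (f (\<gamma> t)) (\<eta> t) w) t"
proof -
  let ?f = "\<lambda>(y, z). f y z"
  define V where "V s = inverse s *\<^sub>R (\<gamma> (t + s) - \<gamma> t)" for s
  define W where "W s = inverse s *\<^sub>R (\<eta> (t + s) - \<eta> t)" for s
  have VW: "(V \<longlongrightarrow> v) (at 0)" "(W \<longlongrightarrow> w) (at 0)"
    using vel unfolding has_velocity_def V_def W_def by simp_all
  have part: "dir_deriv ?f (\<gamma> t, \<eta> t) (v, 0) = dir_deriv (\<lambda>y. f y (\<eta> t)) (\<gamma> t) v"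
    "dir_deriv ?f (\<gamma> t, \<eta> t) (0, w) = dir_deriv (f (\<gamma> t)) (\<eta> t) w"
    by (simp_all add: dir_deriv_def dir_quotient_def[abs_def])
  have "((\<lambda>s. inverse s *\<^sub>R (?f ((\<gamma> t, \<eta> t) + s *\<^sub>R (V s, 0)) - ?f (\<gamma> t, \<eta> t))
            + inverse s *\<^sub>R (?f ((\<gamma> (t + s), \<eta> t) + s *\<^sub>R (0, W s)) - ?f (\<gamma> (t + s), \<eta> t)))
          \<longlongrightarrow> dir_deriv ?f (\<gamma> t, \<eta> t) (v, 0) + dir_deriv ?f (\<gamma> t, \<eta> t) (0, w)) (at 0)"
    by (intro tendsto_add strictly_differentiable[OF sm U] tendsto_Pair tendsto_const VW
        has_velocity_imp_tendsto[OF vel(1)])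
  then show ?thesis unfolding has_velocity_def part
    by (rule Lim_transform_eventually)
       (auto simp: eventually_at_filter V_def W_def scaleR_add_right[symmetric])
qed

lemma continuous_bilinear_tendsto:
  assumes "continuous_bilinear b" "(f \<longlongrightarrow> x) F" "(g \<longlongrightarrow> y) F"
  shows "((\<lambda>s. b (f s) (g s)) \<longlongrightarrow> b x y) F"
proof -
  have "isCont (\<lambda>(x, y). b x y) (x, y)"
    using assms(1) unfolding continuous_bilinear_def
    by (simp add: continuous_on_eq_continuous_at)
  from isCont_tendsto_compose[OF this tendsto_Pair[OF assms(2,3)]] show ?thesis by simp
qed

lemma has_velocity_bilinear:
  assumes b: "continuous_bilinear b" and f: "has_velocity f f' t" and g: "has_velocity g g' t"
  shows "has_velocity (\<lambda>s. b (f s) (g s)) (b f' (g t) + b (f t) g') t"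
proof -
  have lin: "linear (b x)" "linear (\<lambda>x. b x y)" for x y
    using b by (simp_all add: continuous_bilinear_def)
  have "((\<lambda>s. b (inverse s *\<^sub>R (f (t + s) - f t)) (g (t + s))
             + b (f t) (inverse s *\<^sub>R (g (t + s) - g t))) \<longlongrightarrow> b f' (g t) + b (f t) g') (at 0)"
    using f g has_velocity_imp_tendsto[OF g]
    by (intro tendsto_add continuous_bilinear_tendsto[OF b] tendsto_const) (simp_all add: has_velocity_def)
  moreover have "b (inverse s *\<^sub>R (f (t + s) - f t)) (g (t + s)) + b (f t) (inverse s *\<^sub>R (g (t + s) - g t))
      = inverse s *\<^sub>R (b (f (t + s)) (g (t + s)) - b (f t) (g t))" for s
    using linear_scale[OF lin(1)] linear_diff[OF lin(1)] linear_scale[OF lin(2)] linear_diff[OF lin(2)]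
    by (simp add: scaleR_add_right[symmetric])
  ultimately show ?thesis unfolding has_velocity_def by simp
qed

section \<open>Curves in charts of a manifold\<close>

lemma
  assumes "smooth_manifold A"
  shows chart_at_in_atlas: "chart_at A p \<in> A" and chart_at_dom: "p \<in> cdom (chart_at A p)"
proof -
  have "p \<in> (\<Union>c\<in>A. cdom c)" using assms by (simp add: smooth_manifold_def)
  then have "\<exists>c. c \<in> A \<and> p \<in> cdom c" by blast
  from someI_ex[OF this] show "chart_at A p \<in> A" "p \<in> cdom (chart_at A p)"
    unfolding chart_at_def by auto
qed

lemma
  assumes "smooth_manifold A" "c \<in> A"
  shows open_chart_dom: "open (cdom c)"
    and open_chart_image: "open (coord c ` cdom c)"
    and param_coord: "p \<in> cdom c \<Longrightarrow> param c (coord c p) = p"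
    and coord_param: "y \<in> coord c ` cdom c \<Longrightarrow> coord c (param c y) = y"
    and param_in_dom: "y \<in> coord c ` cdom c \<Longrightarrow> param c y \<in> cdom c"
    and continuous_on_coord: "continuous_on (cdom c) (coord c)"
proof -
  have "open (cdom c)" "open (coord c ` cdom c)"
    and h: "homeomorphism (cdom c) (coord c ` cdom c) (coord c) (param c)"
    using assms by (auto simp: smooth_manifold_def)
  then show "open (cdom c)" "open (coord c ` cdom c)" by auto
  show "p \<in> cdom c \<Longrightarrow> param c (coord c p) = p"
    "y \<in> coord c ` cdom c \<Longrightarrow> coord c (param c y) = y"
    "y \<in> coord c ` cdom c \<Longrightarrow> param c y \<in> cdom c"
    "continuous_on (cdom c) (coord c)"
    using h unfolding homeomorphism_def by auto
qed

lemma smooth_transition: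
  "smooth_manifold A \<Longrightarrow> c \<in> A \<Longrightarrow> c' \<in> A \<Longrightarrow>
     smooth_on (coord c ` (cdom c \<inter> cdom c')) (coord c' \<circ> param c)"
  by (simp add: smooth_manifold_def)

lemma chart_at_std [simp]: "chart_at std_atlas x = (UNIV, \<lambda>x. x)"
  unfolding chart_at_def std_atlas_def by (rule some_equality) auto

lemma param_std [simp]: "param (UNIV, \<lambda>x. x) = (\<lambda>x. x)"
  by (simp add: param_def inv_equality ext)

lemma tangent_map_zero [simp]: "tangent_map A B f p 0 = 0"
  by (simp add: tangent_map_def)

lemma eventually_in_open_along:
  "has_velocity \<gamma> v t \<Longrightarrow> open U \<Longrightarrow> \<gamma> t \<in> U \<Longrightarrow> \<forall>\<^sub>F s in at 0. \<gamma> (t + s) \<in> U"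
  using has_velocity_imp_tendsto topological_tendstoD by blast

text \<open>Chain rule for a transition map and its inverse, along the straight curve with velocity \<open>w\<close> in the
second chart.\<close>

lemma dir_deriv_transition_inverse:
  assumes A: "smooth_manifold A" "c \<in> A" "c' \<in> A" and p: "p \<in> cdom c" "p \<in> cdom c'"
  shows "dir_deriv (coord c' \<circ> param c) (coord c p)
           (dir_deriv (coord c \<circ> param c') (coord c' p) w) = w"
proof -
  let ?U = "coord c ` (cdom c \<inter> cdom c')" and ?U' = "coord c' ` (cdom c' \<inter> cdom c)"
  define \<gamma> where "\<gamma> s = (coord c \<circ> param c') (coord c' p + s *\<^sub>R w)" for s
  have "has_velocity \<gamma> (dir_deriv (coord c \<circ> param c') (coord c' p + 0 *\<^sub>R w) w) 0"
    unfolding \<gamma>_def using p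
    by (intro has_velocity_compose[OF smooth_transition[OF A(1,3,2)]] has_velocity_line) auto
  moreover have \<gamma>0: "\<gamma> 0 = coord c p" using p A by (simp add: \<gamma>_def param_coord)
  ultimately have "has_velocity (\<lambda>s. (coord c' \<circ> param c) (\<gamma> s))
      (dir_deriv (coord c' \<circ> param c) (\<gamma> 0) (dir_deriv (coord c \<circ> param c') (coord c' p) w)) 0"
    using p by (intro has_velocity_compose[OF smooth_transition[OF A(1,2,3)]]) auto
  moreover have "has_velocity (\<lambda>s. (coord c' \<circ> param c) (\<gamma> s)) w 0"
  proof -
    have "open ?U'" by (rule smooth_on_imp_open[OF smooth_transition[OF A(1,3,2)]])
    then have "\<forall>\<^sub>F s in at (0::real). coord c' p + s *\<^sub>R w \<in> ?U'"
      using p by (intro eventually_line_in_open) auto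
    then have "\<forall>\<^sub>F s in at 0. (coord c' \<circ> param c) (\<gamma> (0 + s)) = coord c' p + (0 + s) *\<^sub>R w"
      by (rule eventually_mono) (auto simp: \<gamma>_def param_coord[OF A(1,2)] param_coord[OF A(1,3)])
    then show ?thesis
      by (subst has_velocity_cong[where g = "\<lambda>s. coord c' p + s *\<^sub>R w"])
         (use p in \<open>auto simp: \<gamma>_def param_coord[OF A(1,2)] param_coord[OF A(1,3)] intro: has_velocity_line\<close>)
  qed
  ultimately show ?thesis unfolding \<gamma>0 by (metis has_velocity_unique)
qed

lemma dir_deriv_coord_param:
  assumes "smooth_manifold A" "c \<in> A" "p \<in> cdom c"
  shows "dir_deriv (coord c \<circ> param c) (coord c p) w = w"
proof -
  have "dir_deriv (coord c \<circ> param c) (coord c p) w = dir_deriv (\<lambda>y. y) (coord c p) w"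
    using assms by (intro dir_deriv_cong[of "coord c ` cdom c"]) (auto simp: open_chart_image param_coord)
  then show ?thesis by (simp add: dir_deriv_ident)
qed

lemma form1_in_chart_at:
  assumes "smooth_manifold A"
  shows "form1_in A (chart_at A p) \<alpha> (coord (chart_at A p) p) v = \<alpha> p v"
proof -
  note c = chart_at_in_atlas[OF assms, of p] chart_at_dom[OF assms, of p]
  show ?thesis
    using dir_deriv_coord_param[OF assms c]
    by (simp add: form1_in_def tangent_map_def param_coord[OF assms c] comp_def)
qed

lemma vf_in_chart_at:
  assumes "smooth_manifold A"
  shows "vf_in A (chart_at A p) X (coord (chart_at A p) p) = X p"
proof -
  note c = chart_at_in_atlas[OF assms, of p] chart_at_dom[OF assms, of p]
  show ?thesis
    using dir_deriv_coord_param[OF assms c]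
    by (simp add: vf_in_def tangent_map_def param_coord[OF assms c] comp_def)
qed

text \<open>The coordinate expressions of \<open>\<alpha>\<close> and \<open>X\<close> involve mutually inverse tangent maps between the chart \<open>c\<close> and the
chart that represents tangent vectors at the point in question, so the pairing does not depend on \<open>c\<close>.\<close>

lemma form1_in_vf_in:
  assumes A: "smooth_manifold A" "c \<in> A" and y: "y \<in> coord c ` cdom c"
  shows "form1_in A c \<alpha> y (vf_in A c X y) = \<alpha> (param c y) (X (param c y))"
proof -
  let ?q = "param c y"
  note c' = chart_at_in_atlas[OF A(1), of ?q] chart_at_dom[OF A(1), of ?q]
  have "dir_deriv (coord (chart_at A ?q) \<circ> param c) (coord c ?q)
          (dir_deriv (coord c \<circ> param (chart_at A ?q)) (coord (chart_at A ?q) ?q) (X ?q)) = X ?q"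
    using A c' y by (intro dir_deriv_transition_inverse[of A]) (auto simp: param_in_dom)
  then show ?thesis
    by (simp add: form1_in_def vf_in_def tangent_map_def coord_param[OF A y] comp_def)
qed

lemma has_velocity_smooth_map:
  assumes A: "smooth_manifold A" and B: "smooth_manifold B" and f: "smooth_map A B f"
    and \<gamma>: "has_velocity \<gamma> u t" "\<gamma> t = coord (chart_at A p) p"
  shows "has_velocity (\<lambda>s. coord (chart_at B (f p)) (f (param (chart_at A p) (\<gamma> s))))
           (tangent_map A B f p u) t"
    and "\<forall>\<^sub>F s in at 0. f (param (chart_at A p) (\<gamma> (t + s))) \<in> cdom (chart_at B (f p))"
proof -
  let ?c = "chart_at A p" and ?c' = "chart_at B (f p)"
  note c = chart_at_in_atlas[OF A, of p] chart_at_dom[OF A, of p]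
  note c' = chart_at_in_atlas[OF B, of "f p"] chart_at_dom[OF B, of "f p"]
  let ?U = "coord ?c ` (cdom ?c \<inter> UNIV \<inter> f -` cdom ?c')"
  have sm: "smooth_on ?U (coord ?c' \<circ> f \<circ> param ?c)"
    using f c c' unfolding smooth_map_on_def by blast
  have U: "\<gamma> t \<in> ?U" using \<gamma> c c' by auto
  show "has_velocity (\<lambda>s. coord ?c' (f (param ?c (\<gamma> s)))) (tangent_map A B f p u) t"
    using has_velocity_compose[OF sm U \<gamma>(1)] \<gamma>(2) by (simp add: tangent_map_def)
  show "\<forall>\<^sub>F s in at 0. f (param ?c (\<gamma> (t + s))) \<in> cdom ?c'"
    by (rule eventually_mono[OF eventually_in_open_along[OF \<gamma>(1) smooth_on_imp_open[OF sm] U]])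
       (auto simp: param_coord[OF A c(1)])
qed

lemma has_velocity_smooth_map_compose:
  assumes A: "smooth_manifold A" and B: "smooth_manifold B" and C: "smooth_manifold C"
    and f: "smooth_map A B f" and g: "smooth_map B C g"
    and \<gamma>: "has_velocity \<gamma> u t" "\<gamma> t = coord (chart_at A p) p"
  shows "has_velocity (\<lambda>s. coord (chart_at C (g (f p))) (g (f (param (chart_at A p) (\<gamma> s)))))
           (tangent_map B C g (f p) (tangent_map A B f p u)) t"
proof -
  let ?c = "chart_at A p" and ?c' = "chart_at B (f p)"
  note c = chart_at_in_atlas[OF A, of p] chart_at_dom[OF A, of p]
  note c' = chart_at_in_atlas[OF B, of "f p"] chart_at_dom[OF B, of "f p"]
  note f\<gamma> = has_velocity_smooth_map[OF A B f \<gamma>]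
  have p: "param ?c (\<gamma> t) = p" using \<gamma>(2) c by (simp add: param_coord[OF A])
  have "has_velocity (\<lambda>s. coord (chart_at C (g (f p)))
            (g (param ?c' (coord ?c' (f (param ?c (\<gamma> s)))))))
          (tangent_map B C g (f p) (tangent_map A B f p u)) t"
    by (rule has_velocity_smooth_map(1)[OF B C g f\<gamma>(1)]) (simp add: p)
  moreover have "\<forall>\<^sub>F s in at 0. param ?c' (coord ?c' (f (param ?c (\<gamma> (t + s)))))
                  = f (param ?c (\<gamma> (t + s)))"
    by (rule eventually_mono[OF f\<gamma>(2)]) (simp add: param_coord[OF B c'(1)])
  ultimately show ?thesis
    by (subst (asm) has_velocity_cong[where
          g = "\<lambda>s. coord (chart_at C (g (f p))) (g (f (param ?c (\<gamma> s))))"])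
       (auto elim: eventually_mono simp: p param_coord[OF B c'])
qed

lemma smooth_manifold_std:
  "smooth_manifold (std_atlas :: ('e, 'e::locally_convex_space) atlas)"
proof -
  have "iter_deriv k (\<lambda>x::'e::locally_convex_space. x) v =
     (if k = 0 then (\<lambda>x. x) else if k = 1 then (\<lambda>_. v 0) else (\<lambda>_. 0))" for k v
    by (induction k) (simp_all add: dir_deriv_ident)
  then have it: "iter_deriv k (\<lambda>x::'e::locally_convex_space. x) =
     (if k = 0 then (\<lambda>v x. x) else if k = 1 then (\<lambda>v _. v 0) else (\<lambda>_ _. 0))" for k
    by (auto simp: fun_eq_iff)
  have "dir_differentiable (\<lambda>x. x) x v" "dir_differentiable (\<lambda>_. c) x v" for x v c :: 'e
    using has_velocity_line[of x v 0]
    by (auto simp: dir_differentiable_def has_velocity_def dir_quotient_def[abs_def])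
  moreover have "continuous_on (UNIV \<times> UNIV) (\<lambda>(x::'e, v::nat \<Rightarrow> 'e). v (0::nat))"
    unfolding case_prod_beta
    by (intro continuous_on_product_then_coordinatewise[OF continuous_on_snd] continuous_on_id)
  ultimately have "smooth_on UNIV (\<lambda>x::'e. x)"
    unfolding smooth_on_def it by (auto simp: case_prod_beta intro!: continuous_intros)
  then show ?thesis
    by (simp add: smooth_manifold_def std_atlas_def homeomorphism_def comp_def)
qed

text \<open>Cartan's formula $d(\alpha(Z))(u) = (\mathcal L_Z\alpha)(u) - d\alpha(Z, u)$, along a curve with
velocity \<open>u\<close>. The product rule gives the derivative of $\alpha(Z(p))$, with the coordinates of $Z(p)$
held fixed, plus $\alpha$ of the derivative of $Z$. Both Lie and exterior
derivative contain the derivative of $\alpha(u)$ in the direction $Z$, with opposite signs.\<close>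

lemma has_velocity_one_form_vf:
  assumes A: "smooth_manifold A" and \<alpha>: "one_form A \<alpha>" and Z: "smooth_vf A Z"
    and \<gamma>: "has_velocity \<gamma> u t" "\<gamma> t = coord (chart_at A p) p"
  shows "has_velocity (\<lambda>s. \<alpha> (param (chart_at A p) (\<gamma> s)) (Z (param (chart_at A p) (\<gamma> s))))
           (lie_deriv1 A Z \<alpha> p u + ext_deriv1 A \<alpha> p u (Z p)) t"
proof -
  let ?c = "chart_at A p" and ?x = "coord (chart_at A p) p"
  note c = chart_at_in_atlas[OF A, of p] chart_at_dom[OF A, of p]
  let ?a = "form1_in A ?c \<alpha>" and ?Z = "vf_in A ?c Z"
  have x: "?x \<in> coord ?c ` cdom ?c" using c by blast
  have sm: "smooth_on (coord ?c ` cdom ?c) ?Z"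
    "smooth_on ((coord ?c ` cdom ?c) \<times> UNIV) (\<lambda>(y, v). ?a y v)"
    using \<alpha> Z c by (auto simp: one_form_def smooth_vf_def)
  \<comment> \<open>the chart chosen at \<open>p\<close> represents tangent vectors at \<open>p\<close> by themselves\<close>
  have at: "?Z ?x = Z p" "?a ?x = \<alpha> p"
    using vf_in_chart_at[OF A] form1_in_chart_at[OF A] by (auto simp: fun_eq_iff)
  have "linear (\<alpha> p)" using \<alpha> by (simp add: one_form_def continuous_linear_def)
  then have D\<alpha>: "dir_deriv (\<alpha> p) z w = \<alpha> p w" for z w by (rule dir_deriv_linear)
  have "has_velocity (\<lambda>s. ?Z (\<gamma> s)) (dir_deriv ?Z (\<gamma> t) u) t"
    using \<gamma> x by (intro has_velocity_compose[OF sm(1)]) simp_all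
  from has_velocity_compose2[OF sm(2) _ \<gamma>(1) this]
  have "has_velocity (\<lambda>s. ?a (\<gamma> s) (?Z (\<gamma> s)))
          (dir_deriv (\<lambda>y. ?a y (Z p)) ?x u + \<alpha> p (dir_deriv ?Z ?x u)) t"
    using \<gamma>(2) x by (simp add: at D\<alpha>)
  moreover have "dir_deriv (\<lambda>y. ?a y (Z p)) ?x u + \<alpha> p (dir_deriv ?Z ?x u)
      = lie_deriv1 A Z \<alpha> p u + ext_deriv1 A \<alpha> p u (Z p)"
    by (simp add: lie_deriv1_def ext_deriv1_def Let_def)
  moreover have "\<forall>\<^sub>F s in at 0. ?a (\<gamma> (t + s)) (?Z (\<gamma> (t + s)))
      = \<alpha> (param ?c (\<gamma> (t + s))) (Z (param ?c (\<gamma> (t + s))))"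
    by (rule eventually_mono[OF eventually_in_open_along[OF \<gamma>(1) open_chart_image[OF A c(1)]]])
       (use x \<gamma>(2) form1_in_vf_in[OF A c(1)] in auto)
  ultimately show ?thesis
    by (subst (asm) has_velocity_cong[where
          g = "\<lambda>s. \<alpha> (param ?c (\<gamma> s)) (Z (param ?c (\<gamma> s)))"])
       (use x \<gamma>(2) form1_in_vf_in[OF A c(1)] in auto)
qed

text \<open>The hypothesis concerns curves in the chart that represents tangent vectors at \<open>p\<close>, but a
neighbourhood has to be exhausted by segments in one fixed chart. Around each of its points, such a
segment is pushed into the chart of that point by a transition map.\<close>

lemma locally_constant_if_stationary:
  fixes F :: "'m::t2_space \<Rightarrow> real"
  assumes A: "smooth_manifold A"
    and stat: "\<And>p \<gamma> u t. has_velocity \<gamma> u t \<Longrightarrow> \<gamma> t = coord (chart_at A p) p \<Longrightarrow>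
      has_velocity (\<lambda>s. F (param (chart_at A p) (\<gamma> s))) 0 t"
  shows "\<exists>T. open T \<and> p \<in> T \<and> (\<forall>q\<in>T. F q = F p)"
proof -
  define c where "c = chart_at A p"
  have c: "c \<in> A" "p \<in> cdom c"
    using chart_at_in_atlas[OF A] chart_at_dom[OF A] by (auto simp: c_def)
  obtain K where K: "open K" "convex K" "coord c p \<in> K" "K \<subseteq> coord c ` cdom c"
    using convex_open_nbhd[OF open_chart_image[OF A c(1)] imageI[OF c(2)]] .
  have flat: "has_velocity (\<lambda>s. F (param c (y + s *\<^sub>R v))) 0 t"
    if yt: "y + t *\<^sub>R v \<in> coord c ` cdom c" for y v t
  proof -
    define q where "q = param c (y + t *\<^sub>R v)"
    define c' where "c' = chart_at A q"
    have q: "q \<in> cdom c" "coord c q = y + t *\<^sub>R v"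
      using yt by (auto simp: q_def param_in_dom[OF A c(1)] coord_param[OF A c(1)])
    have c': "c' \<in> A" "q \<in> cdom c'"
      using chart_at_in_atlas[OF A] chart_at_dom[OF A] by (auto simp: c'_def)
    let ?U = "coord c ` (cdom c \<inter> cdom c')" and ?\<gamma> = "\<lambda>s. (coord c' \<circ> param c) (y + s *\<^sub>R v)"
    note tr = smooth_transition[OF A c(1) c'(1)]
    have U: "y + t *\<^sub>R v \<in> ?U" using q c' by force
    have "has_velocity ?\<gamma> (dir_deriv (coord c' \<circ> param c) (y + t *\<^sub>R v) v) t"
      by (rule has_velocity_compose[OF tr U has_velocity_line])
    then have "has_velocity (\<lambda>s. F (param c' (?\<gamma> s))) 0 t"
      unfolding c'_def by (rule stat) (simp add: q_def)
    moreover have "\<forall>\<^sub>F s in at 0. F (param c' (?\<gamma> (t + s))) = F (param c (y + (t + s) *\<^sub>R v))"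
      by (rule eventually_mono[OF eventually_in_open_along[OF has_velocity_line smooth_on_imp_open[OF tr] U]])
         (auto simp: param_coord[OF A c(1)] param_coord[OF A c'(1)])
    ultimately show ?thesis
      by (subst (asm) has_velocity_cong[where g = "\<lambda>s. F (param c (y + s *\<^sub>R v))"])
         (use c' param_coord[OF A c'(1)] in \<open>auto simp: q_def\<close>)
  qed
  show ?thesis
  proof (intro exI conjI ballI)
    show "open (coord c -` K \<inter> cdom c)"
      using continuous_on_coord[OF A c(1)] open_chart_dom[OF A c(1)] K(1)
      by (metis continuous_on_open_vimage)
    show "p \<in> coord c -` K \<inter> cdom c" using c K by simp
    fix q assume q: "q \<in> coord c -` K \<inter> cdom c"
    define y where "y = coord c p"
    define v where "v = coord c q - coord c p"
    have "y + s *\<^sub>R v \<in> K" if "0 \<le> s" "s \<le> 1" for s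
    proof -
      have "(1 - s) *\<^sub>R coord c p + s *\<^sub>R coord c q \<in> K"
        using that q K by (intro convexD) auto
      then show ?thesis by (simp add: y_def v_def algebra_simps)
    qed
    then have "((\<lambda>s. F (param c (y + s *\<^sub>R v))) has_real_derivative 0) (at s)" if "0 \<le> s" "s \<le> 1" for s
      unfolding has_velocity_real_iff[symmetric] using K(4) that by (intro flat) blast
    then have "F (param c (y + 1 *\<^sub>R v)) = F (param c (y + 0 *\<^sub>R v))"
      by (intro DERIV_isconst_end) (auto intro!: continuous_at_imp_continuous_on DERIV_isCont)
    then show "F q = F p" using q c by (simp add: y_def v_def param_coord[OF A c(1)])
  qed
qed

section \<open>The differential of the Futaki invariant\<close>

lemma const_vf_theta:
  "homeomorphism UNIV UNIV (\<theta> p) (inv_into UNIV (\<theta> p)) \<Longrightarrow> const_vf \<theta> (\<theta> p v) p = v"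
  by (simp add: const_vf_def homeomorphism_def)

text \<open>The cancellation described above, for a curve with velocity \<open>u\<close> through \<open>p\<close>: the derivative of $J \circ \chi$
contributes $\kappa_a(C_p\xi,\eta)$, that of $\theta(Z)$ contributes $\kappa_a(J(\chi(p)),[\xi,\eta])$.\<close>

lemma futaki_lift_stationary:
  assumes P: "smooth_manifold AP" and M: "smooth_manifold AM"
    and chi: "smooth_map AP AM chi" and J: "smooth_map AM std_atlas J"
    and \<theta>: "one_form AP \<theta>" "\<And>p. homeomorphism UNIV UNIV (\<theta> p) (inv_into UNIV (\<theta> p))"
    and Z: "smooth_vf AP (star \<zeta>)" "\<And>p. tangent_map AP AM chi p (star \<zeta> p) = 0"
    and \<kappa>\<^sub>a: "continuous_bilinear \<kappa>\<^sub>a" "\<And>\<mu> \<xi>. \<xi> \<in> \<gg> \<Longrightarrow> \<kappa>\<^sub>a \<mu> \<xi> = 0"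
    and equi: "alg_equivariant br AP AM chi \<theta> \<kappa>\<^sub>a J \<sigma>"
    and tf: "torsion_free br \<gg> AP \<theta>" and lie: "\<And>p v. lie_deriv1 AP (star \<zeta>) \<theta> p v \<in> \<gg>"
    and \<gamma>: "has_velocity \<gamma> u t" "\<gamma> t = coord (chart_at AP p) p"
  shows "has_velocity (\<lambda>s. futaki_lift chi \<theta> \<kappa>\<^sub>a J star \<zeta> (param (chart_at AP p) (\<gamma> s))) 0 t"
proof -
  let ?Z = "star \<zeta>" and ?h = "J (chi p)" and ?q = "\<lambda>s. param (chart_at AP p) (\<gamma> s)"
  let ?\<xi> = "\<theta> p u" and ?\<eta> = "\<theta> p (?Z p)"
  define D where "D = lie_deriv1 AP ?Z \<theta> p u + ext_deriv1 AP \<theta> p u (?Z p)"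
  have q: "?q t = p"
    using \<gamma>(2) param_coord[OF P chart_at_in_atlas[OF P] chart_at_dom[OF P], of p] by simp
  have add: "\<kappa>\<^sub>a \<mu> (x + y) = \<kappa>\<^sub>a \<mu> x + \<kappa>\<^sub>a \<mu> y" for \<mu> x y
    using \<kappa>\<^sub>a(1) by (simp add: continuous_bilinear_def linear_add)
  have zero: "\<kappa>\<^sub>a 0 x = 0" for x
    using \<kappa>\<^sub>a(1) linear_0 unfolding continuous_bilinear_def by metis
  have "has_velocity (\<lambda>s. J (chi (?q s))) (tangent_map AM std_atlas J (chi p) (tangent_map AP AM chi p u)) t"
    using has_velocity_smooth_map_compose[OF P M smooth_manifold_std chi J \<gamma>] by simp
  then have "has_velocity (\<lambda>s. J (chi (?q s))) (calabi AP AM chi \<theta> J p ?\<xi>) t"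
    by (simp add: calabi_def rho_def const_vf_theta[of \<theta>, OF \<theta>(2)])
  from has_velocity_bilinear[OF \<kappa>\<^sub>a(1) this has_velocity_one_form_vf[OF P \<theta>(1) Z(1) \<gamma>]]
  have "has_velocity (\<lambda>s. \<kappa>\<^sub>a (J (chi (?q s))) (\<theta> (?q s) (?Z (?q s))))
      (\<kappa>\<^sub>a (calabi AP AM chi \<theta> J p ?\<xi>) ?\<eta> + \<kappa>\<^sub>a ?h D) t"
    unfolding q D_def .
  moreover have "\<kappa>\<^sub>a ?h D = \<kappa>\<^sub>a ?h (br ?\<xi> ?\<eta>)"
  proof -
    have "curvature br AP \<theta> p u (?Z p) \<in> \<gg>" using tf by (simp add: torsion_free_def)
    moreover have "D = lie_deriv1 AP ?Z \<theta> p u + (curvature br AP \<theta> p u (?Z p) + br ?\<xi> ?\<eta>)"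
      by (simp add: D_def curvature_def)
    ultimately show ?thesis using lie by (simp add: add \<kappa>\<^sub>a(2))
  qed
  moreover have "\<kappa>\<^sub>a (calabi AP AM chi \<theta> J p ?\<xi>) ?\<eta> = - \<kappa>\<^sub>a ?h (br ?\<xi> ?\<eta>)"
  proof -
    have "calabi AP AM chi \<theta> J p ?\<eta> = 0"
      by (simp add: calabi_def rho_def const_vf_theta[of \<theta>, OF \<theta>(2)] Z(2))
    moreover have "\<kappa>\<^sub>a (calabi AP AM chi \<theta> J p ?\<xi>) ?\<eta> - \<kappa>\<^sub>a (calabi AP AM chi \<theta> J p ?\<eta>) ?\<xi>
        = - \<kappa>\<^sub>a ?h (br ?\<xi> ?\<eta>)"
      using equi unfolding alg_equivariant_def by blast
    ultimately show ?thesis by (simp add: zero)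
  qed
  ultimately show ?thesis by (simp add: futaki_lift_def)
qed

section \<open>Descent to the base\<close>

text \<open>In a trivialization, $G$ acts on the fibre as left multiplication.\<close>

lemma fibre_transitive:
  assumes pb: "principal_bundle G AG AP AB act pr" and pq: "pr p = pr q"
  shows "\<exists>g. act g p = q"
proof -
  obtain U \<Phi> \<Psi> where U: "pr q \<in> U" and \<Psi>: "\<And>p. p \<in> pr -` U \<Longrightarrow> \<Psi> (\<Phi> p) = p"
    and snd\<Phi>: "\<And>p. p \<in> pr -` U \<Longrightarrow> snd (\<Phi> p) = pr p"
    and eq: "\<And>g p. p \<in> pr -` U \<Longrightarrow> pr (act g p) = pr p \<and> fst (\<Phi> (act g p)) = g \<otimes>\<^bsub>G\<^esub> fst (\<Phi> p)"
    using pb unfolding principal_bundle_def by metis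
  have "group G" and G: "carrier G = UNIV"
    using pb by (simp_all add: principal_bundle_def lie_group_def)
  interpret group G by fact
  define g where "g = fst (\<Phi> q) \<otimes>\<^bsub>G\<^esub> m_inv G (fst (\<Phi> p))"
  have pU: "p \<in> pr -` U" "q \<in> pr -` U" using U pq by auto
  have gU: "act g p \<in> pr -` U" using eq[OF pU(1), of g] pU by simp
  have "fst (\<Phi> (act g p)) = fst (\<Phi> q)"
    using eq[OF pU(1), of g] by (simp add: g_def G m_assoc)
  moreover have "snd (\<Phi> (act g p)) = snd (\<Phi> q)"
    using snd\<Phi>[OF gU] snd\<Phi>[OF pU(2)] eq[OF pU(1), of g] pq by simp
  ultimately have "\<Phi> (act g p) = \<Phi> q" by (rule prod_eqI)
  then have "act g p = q" using \<Psi>[OF gU] \<Psi>[OF pU(2)] by metis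
  then show ?thesis ..
qed

text \<open>The unit section of a local trivialization; its values lie over the right points since the
trivialization is onto and compatible with the projection.\<close>

lemma local_section:
  assumes pb: "principal_bundle G AG AP AB act pr"
  obtains U s where "open U" "b \<in> U" "continuous_on U s" "\<And>b. b \<in> U \<Longrightarrow> pr (s b) = b"
proof -
  obtain U \<Phi> \<Psi> where U: "open U" "b \<in> U" and sm: "smooth_map_on (prod_atlas AG AB) AP (UNIV \<times> U) \<Psi>"
    and bij: "bij_betw \<Phi> (pr -` U) (UNIV \<times> U)"
    and \<Psi>: "\<And>p. p \<in> pr -` U \<Longrightarrow> \<Psi> (\<Phi> p) = p"
    and snd\<Phi>: "\<And>p. p \<in> pr -` U \<Longrightarrow> snd (\<Phi> p) = pr p"
    using pb unfolding principal_bundle_def by metis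
  show thesis
  proof
    have "continuous_on (UNIV \<times> U) \<Psi>" using sm by (simp add: smooth_map_on_def)
    then show "continuous_on U (\<lambda>b. \<Psi> (\<one>\<^bsub>G\<^esub>, b))"
      by (rule continuous_on_compose2) (auto intro!: continuous_intros)
    fix b' assume "b' \<in> U"
    then have "(\<one>\<^bsub>G\<^esub>, b') \<in> \<Phi> ` (pr -` U)"
      using bij_betw_imp_surj_on[OF bij] by simp
    then obtain p where p: "p \<in> pr -` U" "\<Phi> p = (\<one>\<^bsub>G\<^esub>, b')"
      by (metis imageE)
    then show "pr (\<Psi> (\<one>\<^bsub>G\<^esub>, b')) = b'" using \<Psi>[OF p(1)] snd\<Phi>[OF p(1)] by simp
  qed (use U in auto)
qed

text \<open>Along an orbit of $G$, $\theta(\zeta^*)$ transforms by $\mathrm{Ad}_g$ and $J \circ \chi$ by the dual action up to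
the cocycle. The duality absorbs the former, and the cocycle pairs to zero.\<close>

lemma futaki_lift_invariant:
  assumes J: "nonequivariance_cocycle G actM coad J \<sigma>"
    and \<theta>: "\<And>g p v. \<theta> (actP g p) (tangent_map AP AP (actP g) p v) = Ad g (\<theta> p v)"
    and chi: "\<And>g p. chi (actP g p) = actM g (chi p)"
    and star: "\<And>g p. star \<zeta> (actP g p) = tangent_map AP AP (actP g) p (star \<zeta> p)"
    and dual: "duality G \<gg> Ad coad \<kappa>\<^sub>a"
    and equi: "alg_equivariant br AP AM chi \<theta> \<kappa>\<^sub>a J \<sigma>"
  shows "futaki_lift chi \<theta> \<kappa>\<^sub>a J star \<zeta> (actP g p) = futaki_lift chi \<theta> \<kappa>\<^sub>a J star \<zeta> p"
proof -
  let ?\<xi> = "\<theta> p (star \<zeta> p)"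
  have "linear (\<lambda>\<mu>. \<kappa>\<^sub>a \<mu> \<xi>)" for \<xi>
    using dual by (simp add: duality_def continuous_bilinear_def)
  then have "\<kappa>\<^sub>a (\<mu> + \<nu>) \<xi> = \<kappa>\<^sub>a \<mu> \<xi> + \<kappa>\<^sub>a \<nu> \<xi>" for \<mu> \<nu> \<xi>
    by (rule linear_add)
  moreover have "J (actM g (chi p)) = coad (m_inv G g) (J (chi p)) + \<sigma> g"
    using J by (simp add: nonequivariance_cocycle_def)
  moreover have "\<kappa>\<^sub>a (coad (m_inv G g) (J (chi p))) (Ad g ?\<xi>) = \<kappa>\<^sub>a (J (chi p)) ?\<xi>"
    using dual by (simp add: duality_def)
  moreover have "\<kappa>\<^sub>a (\<sigma> g) (Ad g ?\<xi>) = 0"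
    using equi by (simp add: alg_equivariant_def)
  ultimately show ?thesis by (simp add: futaki_lift_def chi star \<theta>)
qed

theorem theorem2p10:
  fixes AM :: "('m::t2_space, 'e::locally_convex_space) atlas"
    and \<omega> :: "'m \<Rightarrow> 'e \<Rightarrow> 'e \<Rightarrow> real"
    and G :: "'g::t2_space monoid"
    and AG :: "('g, 'l::locally_convex_space) atlas"
    and actM :: "'g \<Rightarrow> 'm \<Rightarrow> 'm"
    and \<kappa> :: "'s::locally_convex_space \<Rightarrow> 'l \<Rightarrow> real"
    and coad :: "'g \<Rightarrow> 's \<Rightarrow> 's"
    and J :: "'m \<Rightarrow> 's"
    and \<sigma> :: "'g \<Rightarrow> 's"
    and br :: "'a::locally_convex_space \<Rightarrow> 'a \<Rightarrow> 'a"
    and \<gg> :: "'a set"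
    and \<iota> :: "'l \<Rightarrow> 'a"
    and Ad :: "'g \<Rightarrow> 'a \<Rightarrow> 'a"
    and AP :: "('p::t2_space, 'x::locally_convex_space) atlas"
    and AB :: "('b::t2_space, 'y::locally_convex_space) atlas"
    and actP :: "'g \<Rightarrow> 'p \<Rightarrow> 'p"
    and \<pi> :: "'p \<Rightarrow> 'b"
    and \<theta> :: "'p \<Rightarrow> 'x \<Rightarrow> 'a"
    and chi :: "'p \<Rightarrow> 'm"
    and \<aa>\<^sub>m :: "'a set"
    and star :: "'a \<Rightarrow> 'p \<Rightarrow> 'x"
    and m :: "'m"
    and \<kappa>\<^sub>a :: "'s \<Rightarrow> 'a \<Rightarrow> real"
    and \<zeta> :: "'a"
  assumes "symplectic_manifold AM \<omega>"
    and "lie_group G AG"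
    and "symplectic_action G AG AM \<omega> actM"
    and "nondegenerate_pairing \<kappa>"
    and "coadjoint_action G AG \<kappa> coad"
    and "momentum_map G AG AM \<omega> actM \<kappa> J"
    and "nonequivariance_cocycle G actM coad J \<sigma>"
    and "klein_pair br \<gg> G AG \<iota> Ad"
    and "cartan_geometry G AG \<iota> Ad AP AB actP \<pi> \<theta>"
    and "orbit_through br AP AM actP actM chi \<aa>\<^sub>m star m"
    and "duality G \<gg> Ad coad \<kappa>\<^sub>a"
    and "alg_equivariant br AP AM chi \<theta> \<kappa>\<^sub>a J \<sigma>"
    and "torsion_free br \<gg> AP \<theta>"
    and "\<zeta> \<in> \<aa>\<^sub>m"
    and "\<forall>p v. lie_deriv1 AP (star \<zeta>) \<theta> p v \<in> \<gg>"
  shows "(\<forall>b. \<exists>U. open U \<and> b \<in> U \<and> futaki \<pi> chi \<theta> \<kappa>\<^sub>a J star \<zeta> constant_on U) \<and>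
         (\<forall>C\<in>components UNIV. futaki \<pi> chi \<theta> \<kappa>\<^sub>a J star \<zeta> constant_on C)"
proof -
  let ?F = "futaki_lift chi \<theta> \<kappa>\<^sub>a J star \<zeta>" and ?f = "futaki \<pi> chi \<theta> \<kappa>\<^sub>a J star \<zeta>"
  note cartan = assms(9)[unfolded cartan_geometry_def]
  note orbit = assms(10)[unfolded orbit_through_def]
  have pb: "principal_bundle G AG AP AB actP \<pi>" using cartan by blast
  have "?F (actP g p) = ?F p" for g p
    using cartan orbit assms(14)
    by (intro futaki_lift_invariant[OF assms(7) _ _ _ assms(11,12)]) auto
  then have fibre: "\<pi> q = \<pi> p \<Longrightarrow> ?F q = ?F p" for p q
    using fibre_transitive[OF pb] by metis
  have descend: "?f (\<pi> p) = ?F p" for p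
    unfolding futaki_def
  proof (rule the_equality)
    show "\<forall>q. \<pi> q = \<pi> p \<longrightarrow> ?F q = ?F p" using fibre by blast
  qed blast
  have stationary: "has_velocity (\<lambda>s. ?F (param (chart_at AP p) (\<gamma> s))) 0 t"
    if "has_velocity \<gamma> u t" "\<gamma> t = coord (chart_at AP p) p" for p \<gamma> u t
  proof (rule futaki_lift_stationary[OF _ _ _ _ _ _ _ _ _ _ assms(12,13) _ that])
    show "smooth_manifold AP" using pb by (simp add: principal_bundle_def)
    show "smooth_manifold AM" using assms(1) by (simp add: symplectic_manifold_def)
    show "smooth_map AM std_atlas J" using assms(6) by (simp add: momentum_map_def)
    show "smooth_vf AP (star \<zeta>)"
      using orbit assms(14) by (simp add: right_lie_algebra_action_def)
    show "continuous_bilinear \<kappa>\<^sub>a" "\<And>\<mu> \<xi>. \<xi> \<in> \<gg> \<Longrightarrow> \<kappa>\<^sub>a \<mu> \<xi> = 0"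
      using assms(11) by (auto simp: duality_def)
  qed (use cartan orbit assms(14,15) in auto)
  \<comment> \<open>a continuous local section pulls the open sets of constancy back to the base\<close>
  have loc: "\<exists>V. open V \<and> b \<in> V \<and> (\<forall>b'\<in>V. ?f b' = ?f b)" for b
  proof -
    obtain U s where U: "open U" "b \<in> U" and s: "continuous_on U s" "\<And>b. b \<in> U \<Longrightarrow> \<pi> (s b) = b"
      by (rule local_section[OF pb, of b]) blast
    have f: "?f b' = ?F (s b')" if "b' \<in> U" for b'
      using descend[of "s b'"] s(2)[OF that] by simp
    have "smooth_manifold AP" using pb by (simp add: principal_bundle_def)
    then have "\<exists>T. open T \<and> s b \<in> T \<and> (\<forall>q\<in>T. ?F q = ?F (s b))"
      by (rule locally_constant_if_stationary[where F = ?F]) (rule stationary)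
    then obtain T where T: "open T" "s b \<in> T" "\<forall>q\<in>T. ?F q = ?F (s b)" by blast
    have "open (s -` T \<inter> U)" using s(1) T(1) U(1) by (metis continuous_on_open_vimage)
    moreover have "?f b' = ?f b" if "b' \<in> s -` T \<inter> U" for b'
    proof -
      have "?f b' = ?F (s b')" using that by (intro f) simp
      also have "\<dots> = ?F (s b)" using that T(3) by blast
      also have "\<dots> = ?f b" by (rule f[OF U(2), symmetric])
      finally show ?thesis .
    qed
    ultimately show ?thesis using T(2) U(2) by (intro exI[of _ "s -` T \<inter> U"]) blast
  qed
  show ?thesis
  proof (intro conjI allI ballI)
    show "\<exists>U. open U \<and> b \<in> U \<and> ?f constant_on U" for b
      using loc[of b] unfolding constant_on_def by blast
    fix C :: "'b set" assume "C \<in> components UNIV"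
    then have "connected C" by (rule in_components_connected)
    then show "?f constant_on C"
    proof (rule locally_constant_imp_constant)
      fix b assume "b \<in> C"
      obtain V where V: "open V" "b \<in> V" "\<forall>b'\<in>V. ?f b' = ?f b" using loc by blast
      have "openin (top_of_set C) (C \<inter> V)" using V(1) by (rule openin_open_Int)
      then show "\<exists>T. openin (top_of_set C) T \<and> b \<in> T \<and> (\<forall>x\<in>T. ?f x = ?f b)"
        using \<open>b \<in> C\<close> V(2,3) by blast
    qed
  qed
qed

end
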